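(* Let $d\in\mathbb{N}$ and let $\lambda=(\lambda_{\mathbf k})_{\mathbf k\in\mathbb{Z}^d}$, $\beta=(\beta_{\mathbf k})_{\mathbf k\in\mathbb{Z}^d}$ have nonzero components with $\varphi_{\lambda,d},\varphi_{\beta,d}\in L_2(\mathbb{T}^d)$. For $m\in\mathbb{N}$ put $$\varepsilon_m=\max\Big\{\sup_{|\mathbf k|_\infty\ge m}|\lambda_{\mathbf k}^{-1}|,\ \sqrt{\sum_{\mathbf j\in\mathbb{Z}^d,\,|\mathbf j|_\infty>0}\Gamma_{m,\mathbf j}^2}\Big\},$$ where $\gamma_{\mathbf k}=\beta_{\mathbf k}^{-1}\alpha_{\mathbf k'}$, $\mathbf k'$ is the unique vector in $\mathbb{Z}^d$ with $|\mathbf k'|_\infty\le m$ and $\frac{k_j-k'_j}{2m+1}\in\mathbb{Z}$ for all $j\in\{1,\dots,d\}$, and $\Gamma_{m,\mathbf j}=\max_{|\mathbf k|_\infty\le m}|\gamma_{\mathbf k+(2m+1)\mathbf j}|$. Then there exists a positive constant $c$ such that for all $f\in\Phi_{\lambda,2}(\mathbb{T}^d)$ and $m\in\mathbb{N}$ $$\|f-Q_m(f)\|_2\le c\,\varepsilon_m\|f\|_{\Phi_{\lambda,2}(\mathbb{T}^d)},$$ and consequently $M_{(2m+1)^d}(U_{\lambda,2}(\mathbb{T}^d),\varphi_{\beta,d})_2\le c\,\varepsilon_m$.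
   Context: $\mathbb{N}=\{1,2,\dots\}$; $\mathbb{T}^d$ is the $d$-dimensional torus $[0,2\pi]^d$ with endpoints identified; $|\mathbf k|_\infty=\max_j|k_j|$. Functions are real-valued (in particular $\varphi_{\lambda,d}$ and $\varphi_{\beta,d}$). $\|f\|_2=(2\pi)^{-d/2}(\int_{\mathbb{T}^d}|f|^2)^{1/2}$; $(f_1*f_2)(\mathbf x)=(2\pi)^{-d}\int_{\mathbb{T}^d}f_1(\mathbf y)f_2(\mathbf x-\mathbf y)d\mathbf y$. $\varphi_{\lambda,d}=\sum_{\mathbf k\in\mathbb{Z}^d}\lambda_{\mathbf k}^{-1}e^{i(\mathbf k,\cdot)}$ in the distributional sense, and similarly $\varphi_{\beta,d}=\sum_{\mathbf k}\beta_{\mathbf k}^{-1}e^{i(\mathbf k,\cdot)}$. $\Phi_{\lambda,2}(\mathbb{T}^d)=\{f=\varphi_{\lambda,d}*g:g\in L_2(\mathbb{T}^d)\}$ with norm $\|f\|_{\Phi_{\lambda,2}(\mathbb{T}^d)}=\|g\|_2$; $U_{\lambda,2}(\mathbb{T}^d)$ is its unit ball. Put $\alpha_{\mathbf k}=\beta_{\mathbf k}/\lambda_{\mathbf k}$, $H_m(\mathbf x)=\sum_{|\mathbf k|_\infty\le m}\alpha_{\mathbf k}e^{i(\mathbf k,\mathbf x)}$, $\delta_m=2\pi/(2m+1)$, $V_m(g)=H_m*g$, and for $f=\varphi_{\lambda,d}*g$ with $g\in L_2(\mathbb{T}^d)$, $$Q_m(f)=\frac1{(2m+1)^d}\sum_{\mathbf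 l\in\{0,1,\dots,2m\}^d}V_m(g)(\delta_m\mathbf l)\,\varphi_{\beta,d}(\cdot-\delta_m\mathbf l).$$ For $\mathbb{W}\subset L_2(\mathbb{T}^d)$, $\psi\in L_2(\mathbb{T}^d)$, $M_n(\mathbb{W},\psi)_2=\sup_{f\in\mathbb{W}}\inf_{c_l\in\mathbb{R},\,\mathbf y_l\in\mathbb{T}^d}\|f-\sum_{l=1}^n c_l\psi(\cdot-\mathbf y_l)\|_2$. The quantity $\varepsilon_m$ may be $+\infty$, in which case the bound is trivial. *)

theory Defs
  imports "HOL-Analysis.Analysis"
begin

text \<open>
  The dimension $d$ is the cardinality of the finite index type \<^typ>\<open>'d\<close>. Functions on the torus
  are $2\pi$-periodic functions on $\mathbb R^d$; integrals are taken over the fundamental cube.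
\<close>

definition torus_cube :: "(real^'d::finite) set" where
  "torus_cube = cbox 0 (\<chi> j. 2 * pi)"

definition torus_periodic :: "(real^'d::finite \<Rightarrow> 'b) \<Rightarrow> bool" where
  "torus_periodic f \<longleftrightarrow> (\<forall>x j. f (x + axis j (2 * pi)) = f x)"

text \<open>
  Real square-integrable functions. Elements are functions rather than classes modulo null sets;
  every class contains a Borel measurable periodic representative.
\<close>
definition L2_torus :: "(real^'d::finite \<Rightarrow> real) set" where
  "L2_torus = {f. torus_periodic f \<and> f \<in> borel_measurable borel \<and>
                  set_integrable lborel torus_cube (\<lambda>x. (f x)\<^sup>2)}"

definition L2_norm :: "(real^'d::finite \<Rightarrow> 'b::real_normed_vector) \<Rightarrow> real" where
  "L2_norm f = sqrt ((LINT x:torus_cube|lborel. (norm (f x))\<^sup>2) / (2 * pi) ^ CARD('d))"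

definition torus_conv ::
  "(real^'d::finite \<Rightarrow> 'b::{real_normed_field, banach, second_countable_topology})
    \<Rightarrow> (real^'d \<Rightarrow> 'b) \<Rightarrow> real^'d \<Rightarrow> 'b" where
  "torus_conv f1 f2 x =
     (LINT y:torus_cube|lborel. f1 y * f2 (x - y)) /\<^sub>R (2 * pi) ^ CARD('d)"

definition char_exp :: "int^'d::finite \<Rightarrow> real^'d \<Rightarrow> complex" where
  "char_exp k x = exp (\<i> * of_real (\<Sum>j\<in>UNIV. of_int (k $ j) * x $ j))"

definition linf :: "int^'d::finite \<Rightarrow> int" where
  "linf k = Max (range (\<lambda>j. \<bar>k $ j\<bar>))"

text \<open>
  \<open>C_diff n f\<close>: all iterated partial derivatives up to order \<open>n\<close> exist and are continuous
  (\<open>axis i 1\<close> is the \<open>i\<close>-th unit vector).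
\<close>
primrec C_diff :: "nat \<Rightarrow> (real^'d::finite \<Rightarrow> complex) \<Rightarrow> bool" where
  "C_diff 0 f \<longleftrightarrow> continuous_on UNIV f"
| "C_diff (Suc n) f \<longleftrightarrow> (\<forall>x. f differentiable (at x)) \<and>
     (\<forall>i. C_diff n (\<lambda>x. frechet_derivative f (at x) (axis i 1)))"

definition test_function :: "(real^'d::finite \<Rightarrow> complex) \<Rightarrow> bool" where
  "test_function \<psi> \<longleftrightarrow> torus_periodic \<psi> \<and> (\<forall>n. C_diff n \<psi>)"

text \<open>
  $\varphi = \sum_k c_k e^{i(k,\cdot)}$ in the distributional sense: the series converges to
  $\varphi$ when paired with any smooth periodic test function.
\<close>
definition distributional_series :: "(real^'d::finite \<Rightarrow> real) \<Rightarrow> (int^'d \<Rightarrow> complex) \<Rightarrow> bool" where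
  "distributional_series \<phi> c \<longleftrightarrow> (\<forall>\<psi>. test_function \<psi> \<longrightarrow>
     ((\<lambda>k. c k * (LINT x:torus_cube|lborel. char_exp k x * \<psi> x)) has_sum
        (LINT x:torus_cube|lborel. of_real (\<phi> x) * \<psi> x)) UNIV)"

text \<open>
  In the following \<open>\<phi>\<close> plays the role of $\varphi_{\lambda,d}$. Equality \<open>f = \<phi> * g\<close> is
  equality in $L_2$, i.e. almost everywhere.
\<close>
definition is_generator ::
  "(real^'d::finite \<Rightarrow> real) \<Rightarrow> (real^'d \<Rightarrow> real) \<Rightarrow> (real^'d \<Rightarrow> real) \<Rightarrow> bool" where
  "is_generator \<phi> f g \<longleftrightarrow> g \<in> L2_torus \<and> (AE x in lborel. f x = torus_conv \<phi> g x)"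

definition Phi_space :: "(real^'d::finite \<Rightarrow> real) \<Rightarrow> (real^'d \<Rightarrow> real) set" where
  "Phi_space \<phi> = {f \<in> L2_torus. \<exists>g. is_generator \<phi> f g}"

text \<open>
  If no Fourier coefficient of \<open>\<phi>\<close> vanishes, the generator is unique up to null sets, so the
  choice made here affects neither the norm nor the values of $V_m(g)$ below.
\<close>
definition generator :: "(real^'d::finite \<Rightarrow> real) \<Rightarrow> (real^'d \<Rightarrow> real) \<Rightarrow> real^'d \<Rightarrow> real" where
  "generator \<phi> f = (SOME g. is_generator \<phi> f g)"

definition Phi_norm :: "(real^'d::finite \<Rightarrow> real) \<Rightarrow> (real^'d \<Rightarrow> real) \<Rightarrow> real" where
  "Phi_norm \<phi> f = L2_norm (generator \<phi> f)"

definition Phi_ball :: "(real^'d::finite \<Rightarrow> real) \<Rightarrow> (real^'d \<Rightarrow> real) set" where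
  "Phi_ball \<phi> = {f \<in> Phi_space \<phi>. Phi_norm \<phi> f \<le> 1}"

definition alpha :: "(int^'d::finite \<Rightarrow> complex) \<Rightarrow> (int^'d \<Rightarrow> complex) \<Rightarrow> int^'d \<Rightarrow> complex" where
  "alpha lam bet k = bet k / lam k"

definition H_kernel ::
  "(int^'d::finite \<Rightarrow> complex) \<Rightarrow> (int^'d \<Rightarrow> complex) \<Rightarrow> nat \<Rightarrow> real^'d \<Rightarrow> complex" where
  "H_kernel lam bet m x = (\<Sum>k | linf k \<le> int m. alpha lam bet k * char_exp k x)"

definition V_op ::
  "(int^'d::finite \<Rightarrow> complex) \<Rightarrow> (int^'d \<Rightarrow> complex) \<Rightarrow> nat \<Rightarrow> (real^'d \<Rightarrow> real)
    \<Rightarrow> real^'d \<Rightarrow> complex" where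
  "V_op lam bet m g = torus_conv (H_kernel lam bet m) (\<lambda>x. complex_of_real (g x))"

definition grid_point :: "nat \<Rightarrow> nat^'d::finite \<Rightarrow> real^'d" where
  "grid_point m l = (\<chi> j. 2 * pi / real (2 * m + 1) * real (l $ j))"

text \<open>
  \<open>\<phi>\<close> and \<open>\<psi>\<close> are $\varphi_{\lambda,d}$ and $\varphi_{\beta,d}$. For real-valued \<open>\<phi>\<close>, \<open>\<psi>\<close>
  the values of $Q_m(f)$ are real, although they are typed as complex numbers.
\<close>
definition Q_op ::
  "(int^'d::finite \<Rightarrow> complex) \<Rightarrow> (int^'d \<Rightarrow> complex) \<Rightarrow> (real^'d \<Rightarrow> real) \<Rightarrow> (real^'d \<Rightarrow> real)
    \<Rightarrow> nat \<Rightarrow> (real^'d \<Rightarrow> real) \<Rightarrow> real^'d \<Rightarrow> complex" where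
  "Q_op lam bet \<phi> \<psi> m f x =
     (\<Sum>l | \<forall>j. l $ j \<le> 2 * m.
        V_op lam bet m (generator \<phi> f) (grid_point m l) * of_real (\<psi> (x - grid_point m l)))
     / of_nat ((2 * m + 1) ^ CARD('d))"

definition residue_vec :: "nat \<Rightarrow> int^'d::finite \<Rightarrow> int^'d" where
  "residue_vec m k = (THE k'. linf k' \<le> int m \<and> (\<forall>j. (2 * int m + 1) dvd (k $ j - k' $ j)))"

definition gamma ::
  "(int^'d::finite \<Rightarrow> complex) \<Rightarrow> (int^'d \<Rightarrow> complex) \<Rightarrow> nat \<Rightarrow> int^'d \<Rightarrow> complex" where
  "gamma lam bet m k = inverse (bet k) * alpha lam bet (residue_vec m k)"

definition Gamma_max ::
  "(int^'d::finite \<Rightarrow> complex) \<Rightarrow> (int^'d \<Rightarrow> complex) \<Rightarrow> nat \<Rightarrow> int^'d \<Rightarrow> real" where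
  "Gamma_max lam bet m j =
     Max ((\<lambda>k. cmod (gamma lam bet m (\<chi> i. k $ i + (2 * int m + 1) * j $ i))) ` {k. linf k \<le> int m})"

definition alias_term ::
  "(int^'d::finite \<Rightarrow> complex) \<Rightarrow> (int^'d \<Rightarrow> complex) \<Rightarrow> nat \<Rightarrow> ennreal" where
  "alias_term lam bet m =
     (if (\<lambda>j. (Gamma_max lam bet m j)\<^sup>2) summable_on {j. linf j > 0}
      then ennreal (sqrt (\<Sum>\<^sub>\<infinity>j | linf j > 0. (Gamma_max lam bet m j)\<^sup>2))
      else \<infinity>)"

definition eps ::
  "(int^'d::finite \<Rightarrow> complex) \<Rightarrow> (int^'d \<Rightarrow> complex) \<Rightarrow> nat \<Rightarrow> ennreal" where
  "eps lam bet m =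
     max (SUP k\<in>{k. linf k \<ge> int m}. ennreal (cmod (inverse (lam k)))) (alias_term lam bet m)"

definition M_approx ::
  "nat \<Rightarrow> (real^'d::finite \<Rightarrow> real) set \<Rightarrow> (real^'d \<Rightarrow> real) \<Rightarrow> ennreal" where
  "M_approx n W \<psi> =
     (SUP f\<in>W. INF c :: nat \<Rightarrow> real. INF y\<in>{y :: nat \<Rightarrow> real^'d. \<forall>l. y l \<in> torus_cube}.
        ennreal (L2_norm (\<lambda>x. f x - (\<Sum>l=1..n. c l * \<psi> (x - y l)))))"

end

theory Submission
  imports Defs
begin

text \<open>
  Averaging over the grid aliases every frequency $k$ to its residue $k'$, so the $k$-th Fourier
  coefficient of $Q_m(f)$ is $\gamma_k \hat g(k')$, where $f = \varphi_\lambda * g$. It agrees with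
  $\hat f(k) = \lambda_k^{-1} \hat g(k)$ for $|k|_\infty \le m$. For the remaining $k$ write
  $k = k' + (2m+1)j$ with $j \neq 0$; then Parseval, $|a - b|^2 \le 2|a|^2 + 2|b|^2$ and
  Bessel's inequality for $g$ give
  $\|f - Q_m(f)\|_2^2 \le 4 \varepsilon_m^2 \|g\|_2^2$. The bound on $M_n$ follows by taking real
  parts of the coefficients of $Q_m(f)$.
\<close>

subsection \<open>The normalised measure on the torus\<close>

text \<open>Normalising Lebesgue measure to total mass one makes the characters orthonormal, so that
  coefficient formulas carry no factor (2 pi)^d. Two obstacles shape the development. Functions live
  on R^d while integrals are taken over a cube, so invariance under x -> t + x and x -> t - x is not
  given; it is obtained by wrapping points back into a half-open cube. And the norm of the error can
  be bounded through its coefficients only if the characters are complete in L2, which is derived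
  from the Stone-Weierstrass theorem on the image of the torus in C^d. The constant c = 2 is the
  square root of 4: both parts of the error contribute at most \<epsilon>_m^2 times the squared norm
  of g, and splitting the square doubles each.\<close>

definition torus_measure :: "(real^'d::finite) measure" where
  "torus_measure = density lborel (\<lambda>x. ennreal (indicator torus_cube x / (2 * pi) ^ CARD('d)))"

lemma sets_torus_measure [measurable_cong, simp]: "sets torus_measure = sets borel"
  by (simp add: torus_measure_def)

lemma space_torus_measure [simp]: "space torus_measure = UNIV"
  by (simp add: torus_measure_def)

lemma torus_cube_borel [measurable]: "(torus_cube :: (real^'d::finite) set) \<in> sets borel"
  by (simp add: torus_cube_def)

lemma integrable_torus_measure:
  fixes f :: "real^'d::finite \<Rightarrow> 'b::{banach, second_countable_topology}"
  assumes [measurable]: "f \<in> borel_measurable borel"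
  shows "integrable torus_measure f \<longleftrightarrow> set_integrable lborel torus_cube f"
proof -
  have "integrable torus_measure f \<longleftrightarrow>
      integrable lborel (\<lambda>x. (indicator torus_cube x / (2 * pi) ^ CARD('d)) *\<^sub>R f x)"
    unfolding torus_measure_def by (subst integrable_density) auto
  also have "(\<lambda>x. (indicator torus_cube x / (2 * pi) ^ CARD('d)) *\<^sub>R f x) =
      (\<lambda>x. (1 / (2 * pi) ^ CARD('d)) *\<^sub>R (indicator torus_cube x *\<^sub>R f x))"
    by (auto simp: fun_eq_iff)
  also have "integrable lborel \<dots> \<longleftrightarrow> set_integrable lborel torus_cube f"
  proof
    assume "integrable lborel (\<lambda>x. (1 / (2 * pi) ^ CARD('d)) *\<^sub>R (indicator torus_cube x *\<^sub>R f x))"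
    then have "integrable lborel (\<lambda>x. ((2 * pi) ^ CARD('d)) *\<^sub>R (1 / (2 * pi) ^ CARD('d)) *\<^sub>R (indicator torus_cube x *\<^sub>R f x))"
      by (rule integrable_scaleR_right)
    then show "set_integrable lborel torus_cube f" by (simp add: set_integrable_def)
  next
    assume "set_integrable lborel torus_cube f"
    then show "integrable lborel (\<lambda>x. (1 / (2 * pi) ^ CARD('d)) *\<^sub>R (indicator torus_cube x *\<^sub>R f x))"
      unfolding set_integrable_def by (rule integrable_scaleR_right)
  qed
  finally show ?thesis .
qed

lemma integral_torus_measure:
  fixes f :: "real^'d::finite \<Rightarrow> 'b::{banach, second_countable_topology}"
  assumes [measurable]: "f \<in> borel_measurable borel"
  shows "(LINT x|torus_measure. f x) = (LINT x:torus_cube|lborel. f x) /\<^sub>R (2 * pi) ^ CARD('d)"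
proof -
  have "(LINT x|torus_measure. f x) =
      (LINT x|lborel. (indicator torus_cube x / (2 * pi) ^ CARD('d)) *\<^sub>R f x)"
    unfolding torus_measure_def by (subst integral_density) auto
  also have "(\<lambda>x. (indicator torus_cube x / (2 * pi) ^ CARD('d)) *\<^sub>R f x) =
      (\<lambda>x. (1 / (2 * pi) ^ CARD('d)) *\<^sub>R (indicator torus_cube x *\<^sub>R f x))"
    by (auto simp: fun_eq_iff)
  also have "integral\<^sup>L lborel \<dots> = (LINT x:torus_cube|lborel. f x) /\<^sub>R (2 * pi) ^ CARD('d)"
    unfolding set_lebesgue_integral_def by (subst integral_scaleR_right) (simp add: divide_inverse)
  finally show ?thesis .
qed

lemma AE_torus_measure:
  assumes "AE x in lborel. P x" shows "AE x in torus_measure. P x"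
  unfolding torus_measure_def using assms by (subst AE_density) auto

section \<open>Half-open cube, period lattice and invariance of the measure\<close>

definition fund_cube :: "(real^'d::finite) set" where
  "fund_cube = {x. \<forall>j. 0 \<le> x $ j \<and> x $ j < 2 * pi}"

definition wrap :: "real^'d::finite \<Rightarrow> real^'d" where
  "wrap x = (\<chi> j. x $ j - 2 * pi * of_int \<lfloor>x $ j / (2 * pi)\<rfloor>)"

definition lattice_vec :: "int^'d::finite \<Rightarrow> real^'d" where
  "lattice_vec n = (\<chi> j. 2 * pi * of_int (n $ j))"

lemma fund_cube_borel [measurable]: "(fund_cube :: (real^'d::finite) set) \<in> sets borel"
  unfolding fund_cube_def by measurable

text \<open>The half-open cube is the one whose lattice translates tile R^d exactly; passing to it
  costs only a part of the frontier of the box, a null set.\<close>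

lemma AE_fund_cube: "AE x in lborel. x \<in> (torus_cube :: (real^'d::finite) set) \<longleftrightarrow> x \<in> fund_cube"
proof -
  have "AE x :: real^'d in lborel. x \<notin> cbox 0 (\<chi> j. 2 * pi) - box 0 (\<chi> j. 2 * pi)"
    using negligible_frontier_interval[of "0::real^'d" "\<chi> j. 2 * pi"]
    by (intro AE_not_in) (auto simp: negligible_iff_null_sets null_sets_completion_iff)
  then show ?thesis
    by eventually_elim (auto simp: torus_cube_def fund_cube_def mem_box_cart intro: less_imp_le)
qed

lemma fund_cube_tile: "\<exists>!n. x - lattice_vec n \<in> (fund_cube :: (real^'d::finite) set)"
proof (rule ex1I)
  show "x - lattice_vec (\<chi> j. \<lfloor>x $ j / (2 * pi)\<rfloor>) \<in> fund_cube"
    using floor_divide_lower[of "2 * pi"] floor_divide_upper[of "2 * pi"]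
    by (auto simp: fund_cube_def lattice_vec_def algebra_simps)
next
  fix n :: "int^'d" assume n: "x - lattice_vec n \<in> fund_cube"
  have "\<lfloor>x $ j / (2 * pi)\<rfloor> = n $ j" for j
  proof (rule floor_unique)
    show "of_int (n $ j) \<le> x $ j / (2 * pi)" "x $ j / (2 * pi) < of_int (n $ j) + 1"
      using n by (auto simp: fund_cube_def lattice_vec_def field_simps)
  qed
  then show "n = (\<chi> j. \<lfloor>x $ j / (2 * pi)\<rfloor>)" by (simp add: vec_eq_iff)
qed

lemma fund_cube_unique:
  fixes x :: "real^'d::finite"
  shows "x - lattice_vec n \<in> fund_cube \<Longrightarrow> x - lattice_vec m \<in> fund_cube \<Longrightarrow> n = m"
  using fund_cube_tile by blast

lemma wrap_eq: "x - lattice_vec n \<in> fund_cube \<Longrightarrow> wrap x = x - lattice_vec n"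
  for x :: "real^'d::finite"
proof -
  assume n: "x - lattice_vec n \<in> fund_cube"
  have "x - lattice_vec (\<chi> j. \<lfloor>x $ j / (2 * pi)\<rfloor>) \<in> fund_cube"
    using floor_divide_lower[of "2 * pi"] floor_divide_upper[of "2 * pi"]
    by (auto simp: fund_cube_def lattice_vec_def algebra_simps)
  with n fund_cube_tile[of x] have "n = (\<chi> j. \<lfloor>x $ j / (2 * pi)\<rfloor>)" by blast
  then show ?thesis by (simp add: wrap_def lattice_vec_def vec_eq_iff)
qed

lemma wrap_measurable [measurable]: "wrap \<in> borel_measurable (borel :: (real^'d::finite) measure)"
proof (subst borel_measurable_euclidean_space, rule ballI)
  fix i :: "real^'d" assume "i \<in> Basis"
  then obtain j where i: "i = axis j 1" by (auto simp: Basis_vec_def)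
  show "(\<lambda>x. wrap x \<bullet> i) \<in> borel_measurable borel"
    unfolding i by (simp add: inner_axis wrap_def)
qed

lemma emeasure_torus_measure:
  fixes A :: "(real^'d::finite) set"
  assumes [measurable]: "A \<in> sets borel"
  shows "emeasure torus_measure A = ennreal (1 / (2 * pi) ^ CARD('d)) * emeasure lborel (A \<inter> fund_cube)"
proof -
  have "emeasure torus_measure A =
      (\<integral>\<^sup>+x. ennreal (indicator torus_cube x / (2 * pi) ^ CARD('d)) * indicator A x \<partial>lborel)"
    unfolding torus_measure_def by (subst emeasure_density) auto
  also have "\<dots> = (\<integral>\<^sup>+x. ennreal (1 / (2 * pi) ^ CARD('d)) * indicator (A \<inter> fund_cube) x \<partial>lborel)"
    using AE_fund_cube by (intro nn_integral_cong_AE) (auto split: split_indicator)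
  also have "\<dots> = ennreal (1 / (2 * pi) ^ CARD('d)) * emeasure lborel (A \<inter> fund_cube)"
    by (subst nn_integral_cmult) auto
  finally show ?thesis .
qed

lemma emeasure_torus_UNIV: "emeasure (torus_measure :: (real^'d::finite) measure) UNIV = 1"
proof -
  have "emeasure (torus_measure :: (real^'d) measure) UNIV =
      ennreal (1 / (2 * pi) ^ CARD('d)) * emeasure lborel (fund_cube :: (real^'d) set)"
    by (subst emeasure_torus_measure) auto
  also have "emeasure lborel (fund_cube :: (real^'d) set) = emeasure lborel (torus_cube :: (real^'d) set)"
    using AE_fund_cube by (intro emeasure_eq_AE) auto
  also have "\<dots> = ennreal ((2 * pi) ^ CARD('d))"
    unfolding torus_cube_def
    by (subst emeasure_lborel_cbox_eq)
      (auto simp: Basis_vec_def inner_axis axis_eq_axis UNION_singleton_eq_range prod.reindex inj_on_def power_mult_distrib)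
  finally show ?thesis by (simp add: ennreal_mult[symmetric])
qed

global_interpretation torus: finite_measure "torus_measure :: (real^'d::finite) measure"
  by standard (simp add: emeasure_torus_UNIV)

text \<open>The sign s is carried along because convolution integrands contain x - y: s = 1 serves
  translations, s = - 1 reflections.\<close>

lemma lborel_shift:
  assumes "s = 1 \<or> s = - 1"
  shows "distr lborel borel (\<lambda>x. t + s *\<^sub>R x) = (lborel :: (real^'d::finite) measure)"
  using lborel_affine[of s t] assms by (auto simp: density_1)

text \<open>
  Both sides are cut along the lattice translates of the fundamental cube; the piece of the cube
  that is sent to the $n$-th translate is moved rigidly, so Lebesgue measure is preserved.
\<close>
lemma distr_wrap:
  fixes t :: "real^'d::finite"
  assumes s: "s = 1 \<or> s = - 1"
  shows "distr torus_measure borel (\<lambda>x. wrap (t + s *\<^sub>R x)) = torus_measure"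
proof (rule measure_eqI)
  fix A assume "A \<in> sets (distr torus_measure borel (\<lambda>x. wrap (t + s *\<^sub>R x)))"
  then have A [measurable]: "A \<in> sets borel" by simp
  define T where "T n x = t + s *\<^sub>R x - lattice_vec n" for n and x :: "real^'d"
  have Tm [measurable]: "T n \<in> borel_measurable borel" for n unfolding T_def by measurable
  have distr_T: "distr lborel borel (T n) = lborel" for n
    using lborel_shift[OF s, of "t - lattice_vec n"] by (simp add: T_def[abs_def] algebra_simps)
  define B where "B n = fund_cube \<inter> T n -` (A \<inter> fund_cube)" for n
  have Bm [measurable]: "B n \<in> sets borel" for n
    using measurable_sets_borel[OF Tm, of "A \<inter> fund_cube"] unfolding B_def by (metis A sets.Int fund_cube_borel)
  \<comment> \<open>\<open>C n\<close> is the image of \<open>B n\<close> under \<open>T n\<close>: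
    since s * s = 1, the vector in its definition is the point that \<open>T n\<close> sends to
    y.\<close>
  define C where "C n = {y \<in> A \<inter> fund_cube. s *\<^sub>R (y - t + lattice_vec n) \<in> fund_cube}" for n
  have Cm [measurable]: "C n \<in> sets borel" for n unfolding C_def by measurable
  have ss: "s * s = 1" using s by auto
  have BC: "emeasure lborel (B n) = emeasure lborel (C n)" for n
  proof -
    have "emeasure lborel (C n) = emeasure (distr lborel borel (T n)) (C n)" by (simp add: distr_T)
    also have "\<dots> = emeasure lborel (T n -` C n)"
      by (subst emeasure_distr) auto
    also have "T n -` C n = B n"
      by (auto simp: B_def C_def T_def ss algebra_simps)
    finally show ?thesis ..
  qed
  have wA: "(\<lambda>x. wrap (t + s *\<^sub>R x)) -` A \<inter> fund_cube = (\<Union>n. B n)"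
  proof (intro set_eqI iffI)
    fix x assume x: "x \<in> (\<lambda>x. wrap (t + s *\<^sub>R x)) -` A \<inter> fund_cube"
    obtain n where "t + s *\<^sub>R x - lattice_vec n \<in> fund_cube" using fund_cube_tile by blast
    with x show "x \<in> (\<Union>n. B n)" by (auto simp: B_def T_def wrap_eq)
  next
    fix x assume "x \<in> (\<Union>n. B n)"
    then show "x \<in> (\<lambda>x. wrap (t + s *\<^sub>R x)) -` A \<inter> fund_cube"
      by (auto simp: B_def T_def wrap_eq)
  qed
  have CA: "A \<inter> fund_cube = (\<Union>n. C n)"
  proof (intro set_eqI iffI)
    fix y assume y: "y \<in> A \<inter> fund_cube"
    obtain n where n: "s *\<^sub>R (y - t) - lattice_vec n \<in> fund_cube" using fund_cube_tile by blast
    \<comment> \<open>The new index n' must solve s n' = - n, so it is - n for s = 1 and n for s = -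
      1.\<close>
    have "s *\<^sub>R (y - t + lattice_vec (if s = 1 then - n else n)) = s *\<^sub>R (y - t) - lattice_vec n"
      using s by (auto simp: lattice_vec_def vec_eq_iff)
    with n y show "y \<in> (\<Union>n. C n)" unfolding C_def by (auto intro!: exI[of _ "if s = 1 then - n else n"])
  qed (auto simp: C_def)
  have dB: "disjoint_family_on B UNIV"
    unfolding disjoint_family_on_def B_def T_def using fund_cube_tile by blast
  have dC: "disjoint_family_on C UNIV"
    unfolding disjoint_family_on_def
  proof safe
    fix n m y assume "n \<noteq> m" and y: "y \<in> C n" "y \<in> C m"
    let ?f = "\<lambda>n. if s = 1 then - n else n :: int^'d"
    have *: "s *\<^sub>R (y - t + lattice_vec n) = s *\<^sub>R (y - t) - lattice_vec (?f n)" for n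
      using s by (auto simp: lattice_vec_def vec_eq_iff)
    have "s *\<^sub>R (y - t) - lattice_vec (?f n) \<in> fund_cube" "s *\<^sub>R (y - t) - lattice_vec (?f m) \<in> fund_cube"
      using y unfolding C_def by (simp_all add: *[symmetric])
    then have "?f n = ?f m" by (rule fund_cube_unique)
    with \<open>n \<noteq> m\<close> have False by (cases "s = 1") simp_all
    then show "y \<in> {}" ..
  qed
  have "emeasure lborel (\<Union>n. B n) = emeasure lborel (\<Union>n. C n)"
    using dB dC by (simp add: emeasure_UN_countable BC)
  moreover have "(\<lambda>x. wrap (t + s *\<^sub>R x)) -` A \<in> sets borel"
    by (intro measurable_sets_borel[OF _ A]) measurable
  moreover have "emeasure (distr torus_measure borel (\<lambda>x. wrap (t + s *\<^sub>R x))) A =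
      emeasure torus_measure ((\<lambda>x. wrap (t + s *\<^sub>R x)) -` A)"
    using A by (subst emeasure_distr) auto
  ultimately show "emeasure (distr torus_measure borel (\<lambda>x. wrap (t + s *\<^sub>R x))) A = emeasure torus_measure A"
    using A by (simp add: emeasure_torus_measure wA CA)
qed simp

lemma periodic_lattice:
  assumes "torus_periodic f" shows "f (x + lattice_vec n) = f x"
proof -
  have nat: "f (x + axis j (2 * pi * real k)) = f x" for x j k
  proof (induction k arbitrary: x)
    case 0
    have "axis j 0 = (0 :: real^_)" by (simp add: axis_def vec_eq_iff)
    then show ?case by (simp del: axis_eq_0_iff)
  next
    case (Suc k)
    have "axis j (2 * pi * real (Suc k)) = axis j (2 * pi * real k) + axis j (2 * pi)"
      by (auto simp: axis_def vec_eq_iff algebra_simps)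
    then show ?case using Suc assms by (simp add: torus_periodic_def add.assoc[symmetric])
  qed
  have int: "f (x + axis j (2 * pi * of_int k)) = f x" for x j k
  proof (cases k rule: int_cases2)
    case (nonneg n) then show ?thesis using nat[of x j n] by simp
  next
    case (nonpos n)
    \<comment> \<open>A shift by a negative multiple is undone by the positive one, applied at the
      shifted point.\<close>
    have "axis j (- (2 * pi * real n)) + axis j (2 * pi * real n) = (0 :: real^'a)"
      by (auto simp: axis_def vec_eq_iff)
    then show ?thesis using nat[of "x + axis j (- (2 * pi * real n))" j n] nonpos
      by (simp add: add.assoc)
  qed
  have "f (x + (\<Sum>j\<in>J. axis j (2 * pi * of_int (n $ j)))) = f x" if "finite J" for J
    using that
  proof (induction J arbitrary: x)
    case (insert j J)
    then show ?case using int[of "x + (\<Sum>j\<in>J. axis j (2 * pi * of_int (n $ j)))" j "n $ j"]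
      by (simp add: ac_simps)
  qed simp
  moreover have "(\<Sum>j\<in>UNIV. axis j (2 * pi * of_int (n $ j))) = lattice_vec n"
    by (simp add: vec_eq_iff lattice_vec_def axis_def)
  ultimately show ?thesis using finite_class.finite_UNIV by metis
qed

lemma periodic_wrap:
  assumes "torus_periodic f" shows "f (wrap x) = f x"
proof -
  have "x = wrap x + lattice_vec (\<chi> j. \<lfloor>x $ j / (2 * pi)\<rfloor>)"
    by (simp add: vec_eq_iff wrap_def lattice_vec_def)
  then show ?thesis using periodic_lattice[OF assms] by metis
qed

text \<open>By periodicity f may be evaluated at the wrapped argument, and \<open>distr_wrap\<close>
  says that the wrapped affine map preserves the measure.\<close>

lemma torus_shift:
  fixes f :: "real^'d::finite \<Rightarrow> 'b::{banach, second_countable_topology}"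
  assumes f: "torus_periodic f" and m: "f \<in> borel_measurable borel" and s: "s = 1 \<or> s = - 1"
  shows "integrable torus_measure (\<lambda>x. f (t + s *\<^sub>R x)) \<longleftrightarrow> integrable torus_measure f"
    and "(LINT x|torus_measure. f (t + s *\<^sub>R x)) = (LINT x|torus_measure. f x)"
proof -
  have [measurable]: "(\<lambda>x. wrap (t + s *\<^sub>R x)) \<in> measurable torus_measure borel" by measurable
  show "integrable torus_measure (\<lambda>x. f (t + s *\<^sub>R x)) \<longleftrightarrow> integrable torus_measure f"
    using integrable_distr_eq[of "\<lambda>x. wrap (t + s *\<^sub>R x)" torus_measure borel f] m
    by (simp add: distr_wrap[OF s] periodic_wrap[OF f])
  show "(LINT x|torus_measure. f (t + s *\<^sub>R x)) = (LINT x|torus_measure. f x)"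
    using integral_distr[of "\<lambda>x. wrap (t + s *\<^sub>R x)" torus_measure borel f] m
    by (simp add: distr_wrap[OF s] periodic_wrap[OF f])
qed

subsection \<open>Fourier coefficients\<close>

lemma norm_char_exp [simp]: "cmod (char_exp k x) = 1"
  by (simp add: char_exp_def norm_exp)

lemma char_exp_0 [simp]: "char_exp 0 x = 1" "char_exp k 0 = 1"
  by (simp_all add: char_exp_def)

lemma char_exp_add: "char_exp (k + l) x = char_exp k x * char_exp l x"
  by (simp add: char_exp_def exp_add[symmetric] ring_distribs sum.distrib)

lemma char_exp_add_arg: "char_exp k (x + y) = char_exp k x * char_exp k y"
  by (simp add: char_exp_def exp_add[symmetric] ring_distribs sum.distrib)

lemma char_exp_minus_arg: "char_exp k (- x) = char_exp (- k) x"
  by (simp add: char_exp_def)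

lemma cnj_char_exp: "cnj (char_exp k x) = char_exp (- k) x"
  by (simp add: char_exp_def exp_cnj sum_negf)

lemma char_exp_axis: "char_exp k (axis j t) = cis (of_int (k $ j) * t)"
  by (simp add: char_exp_def cis_conv_exp axis_def if_distrib[of "\<lambda>a. _ * a"] cong: if_cong)

lemma continuous_char_exp: "continuous_on UNIV (char_exp k)"
  unfolding char_exp_def[abs_def] by (intro continuous_intros)

lemma measurable_char_exp [measurable]: "char_exp k \<in> borel_measurable borel"
  by (rule borel_measurable_continuous_onI[OF continuous_char_exp])

lemma periodic_char_exp: "torus_periodic (char_exp k)"
  unfolding torus_periodic_def
  using cis_multiple_2pi[of "of_int _"]
  by (auto simp: char_exp_add_arg char_exp_axis mult.commute[of _ "2 * pi"])

lemma integral_char_exp: "(LINT x|torus_measure. char_exp k x) = (if k = 0 then 1 else 0)"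
proof (cases "k = 0")
  case True
  then show ?thesis by (simp add: measure_def emeasure_torus_UNIV)
next
  case False
  then obtain j where j: "k $ j \<noteq> 0" by (auto simp: vec_eq_iff)
  txt \<open>Translation by \<open>t\<close> flips the sign of the character, hence of its integral.\<close>
  define t where "t = axis j (pi / of_int (k $ j))"
  have t: "char_exp k t = - 1" using j by (simp add: t_def char_exp_axis)
  have "(LINT x|torus_measure. char_exp k (t + 1 *\<^sub>R x)) = (LINT x|torus_measure. char_exp k x)"
    by (rule torus_shift) (auto simp: periodic_char_exp)
  then show ?thesis using False by (simp add: char_exp_add_arg t)
qed

lemma deriv_char_exp:
  "(char_exp k has_derivative
     (\<lambda>h. char_exp k x * (\<i> * of_real (\<Sum>j\<in>UNIV. of_int (k $ j) * h $ j)))) (at x)"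
proof -
  have lin: "((\<lambda>x. \<i> * of_real (\<Sum>j\<in>UNIV. of_int (k $ j) * x $ j)) has_derivative
      (\<lambda>h. \<i> * of_real (\<Sum>j\<in>UNIV. of_int (k $ j) * h $ j))) (at x)"
    by (intro bounded_linear_imp_has_derivative linear_conv_bounded_linear[THEN iffD1] linearI)
      (auto simp: ring_distribs sum.distrib sum_distrib_left scaleR_conv_of_real[where 'a = complex] mult_ac)
  show ?thesis
    unfolding char_exp_def[abs_def]
    using has_derivative_compose[OF lin DERIV_exp[unfolded has_field_derivative_def]] .
qed

text \<open>The constant factor makes the induction on the order of differentiability go through.\<close>
lemma test_function_char_exp: "test_function (char_exp k)"
proof -
  have "C_diff n (\<lambda>x. c * char_exp k x)" for n c
  proof (induction n arbitrary: c)
    case 0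
    show ?case using continuous_char_exp by (auto intro!: continuous_intros)
  next
    case (Suc n)
    have D: "((\<lambda>x. c * char_exp k x) has_derivative
     (\<lambda>h. c * (char_exp k x * (\<i> * of_real (\<Sum>j\<in>UNIV. of_int (k $ j) * h $ j))))) (at x)" for x
      using has_derivative_mult_right[OF deriv_char_exp] .
    have "frechet_derivative (\<lambda>x. c * char_exp k x) (at x) (axis i 1) =
        (c * (\<i> * of_int (k $ i))) * char_exp k x" for x i
      by (subst frechet_derivative_at[OF D, symmetric])
        (simp add: axis_def if_distrib[of "\<lambda>a. _ * a"] mult_ac cong: if_cong)
    with D Suc show ?case by (auto simp: differentiable_def)
  qed
  from this[of _ 1] show ?thesis by (simp add: test_function_def periodic_char_exp)
qed

section \<open>Square-integrable functions, Fourier coefficients and Bessel's inequality\<close>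

definition coef :: "(real^'d::finite \<Rightarrow> complex) \<Rightarrow> int^'d \<Rightarrow> complex" where
  "coef F k = (LINT x|torus_measure. F x * char_exp (- k) x)"

definition sq_int :: "(real^'d::finite \<Rightarrow> complex) \<Rightarrow> bool" where
  "sq_int F \<longleftrightarrow> F \<in> borel_measurable borel \<and> integrable torus_measure (\<lambda>x. (cmod (F x))\<^sup>2)"

lemma sq_int_measurable: "sq_int F \<Longrightarrow> F \<in> borel_measurable borel"
  by (simp add: sq_int_def)

lemma norm_add_sq: "(cmod (a + b))\<^sup>2 \<le> 2 * (cmod a)\<^sup>2 + 2 * (cmod b)\<^sup>2"
proof -
  have "(cmod (a + b))\<^sup>2 \<le> (cmod a + cmod b)\<^sup>2" by (intro power_mono norm_triangle_ineq) auto
  then show ?thesis using sum_squares_bound[of "cmod a" "cmod b"] by (simp add: power2_sum)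
qed

lemma sq_int_add:
  assumes F: "sq_int F" and G: "sq_int G"
  shows "sq_int (\<lambda>x. F x + G x)"
proof -
  note [measurable] = sq_int_measurable[OF F] sq_int_measurable[OF G]
  have "integrable torus_measure (\<lambda>x. (cmod (F x + G x))\<^sup>2)"
    by (rule Bochner_Integration.integrable_bound[where f = "\<lambda>x. 2 * (cmod (F x))\<^sup>2 + 2 * (cmod (G x))\<^sup>2"])
      (use F G in \<open>auto simp: sq_int_def norm_add_sq\<close>)
  then show ?thesis by (simp add: sq_int_def)
qed

lemma sq_int_mult: "sq_int F \<Longrightarrow> sq_int (\<lambda>x. c * F x)"
  by (auto simp: sq_int_def norm_mult power_mult_distrib)

lemma sq_int_diff: "sq_int F \<Longrightarrow> sq_int G \<Longrightarrow> sq_int (\<lambda>x. F x - G x)"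
  using sq_int_add[of F "\<lambda>x. - 1 * G x"] sq_int_mult[of G "- 1"] by simp

lemma sq_int_bounded:
  assumes [measurable]: "F \<in> borel_measurable borel" and "\<And>x. cmod (F x) \<le> B"
  shows "sq_int F"
proof -
  have "(cmod (F x))\<^sup>2 \<le> B\<^sup>2" for x using assms(2) by (intro power_mono) auto
  then show ?thesis
    unfolding sq_int_def by (auto intro!: torus.integrable_const_bound[of _ "B\<^sup>2"])
qed

lemma sq_int_0: "sq_int (\<lambda>x. 0)" by (simp add: sq_int_def)

lemma sq_int_sum: "(\<And>i. i \<in> I \<Longrightarrow> sq_int (F i)) \<Longrightarrow> sq_int (\<lambda>x. \<Sum>i\<in>I. F i x)"
  by (induction I rule: infinite_finite_induct) (auto intro: sq_int_add sq_int_0)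

lemma sq_int_trig_sum: "sq_int (\<lambda>x. \<Sum>k\<in>K. c k * char_exp k x)"
  by (intro sq_int_sum sq_int_mult sq_int_bounded[of _ 1]) auto

lemma integrable_sq_int_mult:
  assumes F: "sq_int F" and G: "sq_int G"
  shows "integrable torus_measure (\<lambda>x. F x * G x)"
proof -
  note [measurable] = sq_int_measurable[OF F] sq_int_measurable[OF G]
  have "cmod (F x * G x) \<le> (cmod (F x))\<^sup>2 + (cmod (G x))\<^sup>2" for x
  proof -
    have "0 \<le> cmod (F x) * cmod (G x)" by simp
    then show ?thesis
      using sum_squares_bound[of "cmod (F x)" "cmod (G x)"] unfolding norm_mult by linarith
  qed
  then have "AE x in torus_measure. norm (F x * G x) \<le> norm ((cmod (F x))\<^sup>2 + (cmod (G x))\<^sup>2)"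
    by (intro always_eventually allI order_trans[OF _ abs_ge_self]) simp
  moreover have "integrable torus_measure (\<lambda>x. (cmod (F x))\<^sup>2 + (cmod (G x))\<^sup>2)"
    using F G by (simp add: sq_int_def)
  ultimately show ?thesis
    by (rule Bochner_Integration.integrable_bound[rotated 2]) measurable
qed

lemma sq_int_char_exp: "sq_int (char_exp k)"
  by (rule sq_int_bounded[of _ 1]) auto

lemma integrable_coef: "sq_int F \<Longrightarrow> integrable torus_measure (\<lambda>x. F x * char_exp k x)"
  by (intro integrable_sq_int_mult sq_int_char_exp)

lemma coef_diff: "sq_int F \<Longrightarrow> sq_int G \<Longrightarrow> coef (\<lambda>x. F x - G x) k = coef F k - coef G k"
  by (simp add: coef_def ring_distribs integrable_coef)

lemma coef_mult: "coef (\<lambda>x. c * F x) k = c * coef F k"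
  by (simp add: coef_def mult.assoc)

lemma coef_sum:
  "(\<And>i. i \<in> I \<Longrightarrow> sq_int (F i)) \<Longrightarrow> coef (\<lambda>x. \<Sum>i\<in>I. F i x) k = (\<Sum>i\<in>I. coef (F i) k)"
  by (simp add: coef_def sum_distrib_right integrable_coef)

lemma coef_char_exp: "coef (char_exp l) k = (if k = l then 1 else 0)"
  by (simp add: coef_def char_exp_add[symmetric] integral_char_exp)

lemma coef_trig:
  assumes "finite K"
  shows "coef (\<lambda>x. \<Sum>k\<in>K. c k * char_exp k x) k = (if k \<in> K then c k else 0)"
  using assms
  by (subst coef_sum) (auto simp: coef_mult coef_char_exp sq_int_mult sq_int_char_exp
      if_distrib[of "\<lambda>a. _ * a"] cong: if_cong)

lemma inner_trig:
  assumes F: "sq_int F"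
  shows "(LINT x|torus_measure. F x * cnj (\<Sum>k\<in>K. c k * char_exp k x)) = (\<Sum>k\<in>K. coef F k * cnj (c k))"
proof -
  have "(LINT x|torus_measure. F x * cnj (\<Sum>k\<in>K. c k * char_exp k x)) =
      (LINT x|torus_measure. (\<Sum>k\<in>K. (F x * char_exp (- k) x) * cnj (c k)))"
    by (simp add: cnj_char_exp sum_distrib_left mult_ac)
  also have "\<dots> = (\<Sum>k\<in>K. coef F k * cnj (c k))"
    by (subst Bochner_Integration.integral_sum) (simp_all add: integrable_coef[OF F] coef_def)
  finally show ?thesis .
qed

text \<open>The Pythagorean identity behind both directions of Parseval: with c equal to the
  coefficients of F it yields \<open>Bessel\<close>, with c taken from a nearby trigonometric
  polynomial it yields \<open>Parseval_le\<close>.\<close>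

lemma norm_diff_trig:
  assumes F: "sq_int F" and K: "finite K"
  shows "(LINT x|torus_measure. (cmod (F x - (\<Sum>k\<in>K. c k * char_exp k x)))\<^sup>2) =
     (LINT x|torus_measure. (cmod (F x))\<^sup>2) - (\<Sum>k\<in>K. (cmod (coef F k))\<^sup>2) + (\<Sum>k\<in>K. (cmod (coef F k - c k))\<^sup>2)"
proof -
  define p where "p x = (\<Sum>k\<in>K. c k * char_exp k x)" for x
  have p: "sq_int p" unfolding p_def[abs_def] by (rule sq_int_trig_sum)
  have cp: "sq_int (\<lambda>x. cnj (p x))"
    using p borel_measurable_continuous_on[of cnj p borel] by (auto simp: sq_int_def intro: continuous_intros)
  have pt: "(cmod (F x - p x))\<^sup>2 = (cmod (F x))\<^sup>2 - 2 * Re (F x * cnj (p x)) + (cmod (p x))\<^sup>2" for x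
    unfolding cmod_power2 by (simp add: power2_eq_square algebra_simps)
  have pp: "(cmod (p x))\<^sup>2 = Re (p x * cnj (p x))" for x
    unfolding cmod_power2 by (simp add: power2_eq_square)
  have "(LINT x|torus_measure. (cmod (F x - p x))\<^sup>2) = (LINT x|torus_measure. (cmod (F x))\<^sup>2)
      - 2 * Re (LINT x|torus_measure. F x * cnj (p x)) + Re (LINT x|torus_measure. p x * cnj (p x))"
  proof -
    have int: "integrable torus_measure (\<lambda>x. (cmod (F x))\<^sup>2)"
      "integrable torus_measure (\<lambda>x. Re (F x * cnj (p x)))" "integrable torus_measure (\<lambda>x. Re (p x * cnj (p x)))"
      using F integrable_sq_int_mult[OF F cp] integrable_sq_int_mult[OF p cp] by (auto simp only: sq_int_def integrable_Re)
    show ?thesis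
      unfolding pt pp integral_Re[OF integrable_sq_int_mult[OF F cp], symmetric]
        integral_Re[OF integrable_sq_int_mult[OF p cp], symmetric]
      by (simp only: int Bochner_Integration.integral_add Bochner_Integration.integral_diff
          Bochner_Integration.integrable_diff integrable_mult_right integral_mult_right_zero simp_thms)
  qed
  also have "\<dots> = (LINT x|torus_measure. (cmod (F x))\<^sup>2)
      - 2 * Re (\<Sum>k\<in>K. coef F k * cnj (c k)) + Re (\<Sum>k\<in>K. coef p k * cnj (c k))"
    using inner_trig[OF F, of c K] inner_trig[OF p, of c K] by (simp add: p_def)
  also have "(\<Sum>k\<in>K. coef p k * cnj (c k)) = (\<Sum>k\<in>K. c k * cnj (c k))"
    unfolding p_def[abs_def] by (intro sum.cong) (auto simp: coef_trig K)
  also have "(LINT x|torus_measure. (cmod (F x))\<^sup>2)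
      - 2 * Re (\<Sum>k\<in>K. coef F k * cnj (c k)) + Re (\<Sum>k\<in>K. c k * cnj (c k)) =
     (LINT x|torus_measure. (cmod (F x))\<^sup>2) - (\<Sum>k\<in>K. (cmod (coef F k))\<^sup>2) + (\<Sum>k\<in>K. (cmod (coef F k - c k))\<^sup>2)"
    unfolding cmod_power2
    by (simp add: sum_distrib_left sum_subtractf[symmetric] sum.distrib[symmetric] algebra_simps
        power2_eq_square)
  finally show ?thesis by (simp add: p_def)
qed

lemma Bessel:
  assumes F: "sq_int F" and K: "finite K"
  shows "(\<Sum>k\<in>K. (cmod (coef F k))\<^sup>2) \<le> (LINT x|torus_measure. (cmod (F x))\<^sup>2)"
proof -
  have "0 \<le> (LINT x|torus_measure. (cmod (F x - (\<Sum>k\<in>K. coef F k * char_exp k x)))\<^sup>2)" by simp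
  then show ?thesis unfolding norm_diff_trig[OF assms] by simp
qed

subsection \<open>Density of trigonometric polynomials\<close>

text \<open>Generated by sums rather than given as one finite sum: closure under products then
  follows by a double induction without index sets, and \<open>trig_sumE\<close> recovers the sum
  when orthogonality is to be applied.\<close>

inductive trig :: "(real^'d::finite \<Rightarrow> complex) \<Rightarrow> bool" where
  trig_char: "trig (\<lambda>x. c * char_exp k x)"
| trig_add: "trig p \<Longrightarrow> trig q \<Longrightarrow> trig (\<lambda>x. p x + q x)"

lemma trig_mult:
  assumes "trig p" "trig q" shows "trig (\<lambda>x. p x * q x)"
  using assms(1)
proof induction
  case (trig_char c k)
  show ?case using assms(2)
  proof induction
    case (trig_char d l)
    have "(\<lambda>x. c * char_exp k x * (d * char_exp l x)) = (\<lambda>x. (c * d) * char_exp (k + l) x)"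
      by (simp add: fun_eq_iff char_exp_add)
    then show ?case using trig.trig_char by metis
  next
    case (trig_add p q)
    then show ?case using trig.trig_add by (simp add: ring_distribs) blast
  qed
next
  case (trig_add p q)
  then show ?case using trig.trig_add by (simp add: ring_distribs) blast
qed

lemma trig_const: "trig (\<lambda>x. c)"
  using trig_char[of c 0] by simp

lemma trig_scale: "trig p \<Longrightarrow> trig (\<lambda>x. c * p x)"
  using trig_mult[OF trig_const] .

lemma trig_sumE:
  assumes "trig p"
  obtains K c where "finite K" "p = (\<lambda>x. \<Sum>k\<in>K. c k * char_exp k x)"
proof -
  have "\<exists>K c. finite K \<and> p = (\<lambda>x. \<Sum>k\<in>K. c k * char_exp k x)"
    using assms
  proof induction
    case (trig_char c k)
    show ?case by (rule exI[of _ "{k}"], rule exI[of _ "\<lambda>_. c"]) simp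
  next
    case (trig_add p q)
    then obtain K c L d where K: "finite K" "p = (\<lambda>x. \<Sum>k\<in>K. c k * char_exp k x)"
      and L: "finite L" "q = (\<lambda>x. \<Sum>k\<in>L. d k * char_exp k x)" by blast
    define e where "e k = (if k \<in> K then c k else 0) + (if k \<in> L then d k else 0)" for k
    have "p x = (\<Sum>k\<in>K \<union> L. (if k \<in> K then c k else 0) * char_exp k x)" for x
      unfolding K(2) using K L by (intro sum.mono_neutral_cong_left) auto
    moreover have "q x = (\<Sum>k\<in>K \<union> L. (if k \<in> L then d k else 0) * char_exp k x)" for x
      unfolding L(2) using K L by (intro sum.mono_neutral_cong_left) auto
    ultimately have "(\<lambda>x. p x + q x) = (\<lambda>x. \<Sum>k\<in>K \<union> L. e k * char_exp k x)"
      by (simp add: fun_eq_iff e_def ring_distribs sum.distrib)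
    with K L show ?case by blast
  qed
  then show ?thesis using that by blast
qed

lemma sq_int_trig: "trig p \<Longrightarrow> sq_int p"
  by (elim trig_sumE) (simp add: sq_int_trig_sum)

definition approximable :: "(real^'d::finite \<Rightarrow> complex) \<Rightarrow> bool" where
  "approximable F \<longleftrightarrow> sq_int F \<and>
     (\<forall>e>0. \<exists>p. trig p \<and> (LINT x|torus_measure. (cmod (F x - p x))\<^sup>2) < e)"

lemma integral_norm_add_sq:
  assumes "sq_int F" "sq_int G"
  shows "(LINT x|torus_measure. (cmod (F x + G x))\<^sup>2) \<le>
     2 * (LINT x|torus_measure. (cmod (F x))\<^sup>2) + 2 * (LINT x|torus_measure. (cmod (G x))\<^sup>2)"
proof -
  have "(LINT x|torus_measure. (cmod (F x + G x))\<^sup>2) \<le>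
      (LINT x|torus_measure. 2 * (cmod (F x))\<^sup>2 + 2 * (cmod (G x))\<^sup>2)"
    using assms sq_int_add[OF assms] by (intro integral_mono) (auto simp: sq_int_def norm_add_sq)
  also have "\<dots> = 2 * (LINT x|torus_measure. (cmod (F x))\<^sup>2) + 2 * (LINT x|torus_measure. (cmod (G x))\<^sup>2)"
    using assms by (simp add: sq_int_def)
  finally show ?thesis .
qed

text \<open>The approximable functions are closed in L2; every limit step below is an instance of
  this.\<close>

lemma approximable_close:
  assumes F: "sq_int F"
    and ex: "\<And>e. e > 0 \<Longrightarrow> \<exists>G. approximable G \<and> (LINT x|torus_measure. (cmod (F x - G x))\<^sup>2) < e"
  shows "approximable F"
  unfolding approximable_def
proof (intro conjI F allI impI)
  fix e :: real assume e: "e > 0"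
  \<comment> \<open>Each of the two squared distances is doubled by
    \<open>integral_norm_add_sq\<close>, so a quarter of e is allotted to each.\<close>
  obtain G where G: "approximable G" "(LINT x|torus_measure. (cmod (F x - G x))\<^sup>2) < e / 4"
    using ex[of "e / 4"] e by auto
  obtain p where p: "trig p" "(LINT x|torus_measure. (cmod (G x - p x))\<^sup>2) < e / 4"
    using G(1) e unfolding approximable_def by (meson zero_less_divide_iff zero_less_numeral)
  have sG: "sq_int G" using G(1) by (simp add: approximable_def)
  have "(LINT x|torus_measure. (cmod (F x - p x))\<^sup>2) \<le>
     2 * (LINT x|torus_measure. (cmod (F x - G x))\<^sup>2) + 2 * (LINT x|torus_measure. (cmod (G x - p x))\<^sup>2)"
    using integral_norm_add_sq[OF sq_int_diff[OF F sG] sq_int_diff[OF sG sq_int_trig[OF p(1)]]] by simp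
  with G(2) p show "\<exists>p. trig p \<and> (LINT x|torus_measure. (cmod (F x - p x))\<^sup>2) < e" by fastforce
qed

lemma approximable_add:
  assumes "approximable F" "approximable G"
  shows "approximable (\<lambda>x. F x + G x)"
  unfolding approximable_def
proof (intro conjI allI impI)
  have F: "sq_int F" and G: "sq_int G" using assms by (auto simp: approximable_def)
  then show "sq_int (\<lambda>x. F x + G x)" by (rule sq_int_add)
  fix e :: real assume e: "e > 0"
  obtain p where p: "trig p" "(LINT x|torus_measure. (cmod (F x - p x))\<^sup>2) < e / 4"
    using assms(1) e unfolding approximable_def by (meson zero_less_divide_iff zero_less_numeral)
  obtain q where q: "trig q" "(LINT x|torus_measure. (cmod (G x - q x))\<^sup>2) < e / 4"
    using assms(2) e unfolding approximable_def by (meson zero_less_divide_iff zero_less_numeral)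
  have "(LINT x|torus_measure. (cmod (F x + G x - (p x + q x)))\<^sup>2) \<le>
     2 * (LINT x|torus_measure. (cmod (F x - p x))\<^sup>2) + 2 * (LINT x|torus_measure. (cmod (G x - q x))\<^sup>2)"
    using integral_norm_add_sq[OF sq_int_diff[OF F sq_int_trig[OF p(1)]] sq_int_diff[OF G sq_int_trig[OF q(1)]]]
    by (simp add: algebra_simps)
  with p q have "(LINT x|torus_measure. (cmod (F x + G x - (p x + q x)))\<^sup>2) < e" by linarith
  with trig_add[OF p(1) q(1)]
  show "\<exists>p. trig p \<and> (LINT x|torus_measure. (cmod (F x + G x - p x))\<^sup>2) < e" by blast
qed

lemma approximable_trig: "trig p \<Longrightarrow> approximable p"
  unfolding approximable_def by (auto intro!: exI[of _ p] simp: sq_int_trig)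

lemma approximable_mult:
  assumes "approximable F" shows "approximable (\<lambda>x. c * F x)"
  unfolding approximable_def
proof (intro conjI allI impI)
  have F: "sq_int F" using assms by (auto simp: approximable_def)
  then show "sq_int (\<lambda>x. c * F x)" by (rule sq_int_mult)
  fix e :: real assume e: "e > 0"
  \<comment> \<open>The summand 1 covers c = 0 and turns the final estimate into a strict
    one.\<close>
  define d where "d = e / ((cmod c)\<^sup>2 + 1)"
  have pos: "(cmod c)\<^sup>2 + 1 > 0" by (simp add: add_nonneg_pos)
  have d: "d > 0" using e pos by (simp add: d_def)
  then obtain p where p: "trig p" "(LINT x|torus_measure. (cmod (F x - p x))\<^sup>2) < d"
    using assms unfolding approximable_def by blast
  have "(LINT x|torus_measure. (cmod (c * F x - c * p x))\<^sup>2) =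
      (cmod c)\<^sup>2 * (LINT x|torus_measure. (cmod (F x - p x))\<^sup>2)"
    by (simp add: right_diff_distrib[symmetric] norm_mult power_mult_distrib)
  also have "\<dots> \<le> (cmod c)\<^sup>2 * d" using p by (intro mult_left_mono) auto
  also have "\<dots> < ((cmod c)\<^sup>2 + 1) * d" using d by simp
  also have "\<dots> = e" using pos by (simp add: d_def)
  finally show "\<exists>p. trig p \<and> (LINT x|torus_measure. (cmod (c * F x - p x))\<^sup>2) < e"
    using trig_scale[OF p(1)] by blast
qed

section \<open>Continuous functions on the torus via Stone-Weierstrass\<close>

definition unit_vec :: "real^'d::finite \<Rightarrow> complex^'d" where
  "unit_vec x = (\<chi> j. cis (x $ j))"

lemma continuous_unit_vec: "continuous_on UNIV unit_vec"
  unfolding unit_vec_def[abs_def] by (intro continuous_intros)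

lemma periodic_unit_vec: "torus_periodic unit_vec"
  by (auto simp: torus_periodic_def unit_vec_def vec_eq_iff axis_def cis_mult[symmetric])

lemma wrap_in_fund_cube: "wrap x \<in> fund_cube"
  using fund_cube_tile[of x] wrap_eq[of x] by metis

lemma fund_cube_subset: "fund_cube \<subseteq> torus_cube"
  by (auto simp: fund_cube_def torus_cube_def mem_box_cart less_imp_le)

text \<open>The image is the torus itself, embedded in C^d as a product of unit circles. By
  periodicity the closed cube already covers it, whence compactness.\<close>

lemma compact_range_unit_vec: "compact (range (unit_vec :: real^'d::finite \<Rightarrow> _))"
proof -
  have "unit_vec x \<in> unit_vec ` torus_cube" for x :: "real^'d"
    using periodic_wrap[OF periodic_unit_vec, of x] wrap_in_fund_cube[of x] fund_cube_subset
    by (metis imageI subsetD)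
  then have "range unit_vec = unit_vec ` (torus_cube :: (real^'d) set)" by blast
  moreover have "compact (unit_vec ` (torus_cube :: (real^'d) set))"
    unfolding torus_cube_def
    by (intro compact_continuous_image continuous_on_subset[OF continuous_unit_vec]) auto
  ultimately show ?thesis by simp
qed

text \<open>Equal values force the coordinates to differ by multiples of 2 pi, but two points of a
  half-open interval of that length differ by less. Injectivity lets a subset of the cube be
  recovered from its image, as \<open>approximable_compact\<close> requires.\<close>

lemma inj_unit_vec: "inj_on unit_vec (fund_cube :: (real^'d::finite) set)"
proof (rule inj_onI)
  fix x y :: "real^'d"
  assume x: "x \<in> fund_cube" and y: "y \<in> fund_cube" and eq: "unit_vec x = unit_vec y"
  have "x $ j = y $ j" for j
  proof -
    have xy: "0 \<le> x $ j" "x $ j < 2 * pi" "0 \<le> y $ j" "y $ j < 2 * pi"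
      using x y by (auto simp: fund_cube_def)
    have "cis (x $ j) = cis (y $ j)" using eq by (simp add: unit_vec_def vec_eq_iff)
    then have "sin (x $ j) = sin (y $ j) \<and> cos (x $ j) = cos (y $ j)" by (simp add: complex_eq_iff)
    then obtain n where n: "x $ j = y $ j + 2 * pi * of_int n"
      by (subst (asm) sin_cos_eq_iff) auto
    have "n = 0"
    proof (rule ccontr)
      assume "n \<noteq> 0"
      then consider "n \<ge> 1" | "n \<le> - 1" by linarith
      then show False
      proof cases
        case 1
        then have "2 * pi * of_int n \<ge> 2 * pi * 1" by (intro mult_left_mono) auto
        then show False using n xy by linarith
      next
        case 2
        then have "2 * pi * of_int n \<le> 2 * pi * (- 1)" by (intro mult_left_mono) auto
        then show False using n xy by linarith
      qed
    qed
    then show ?thesis using n by simp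
  qed
  then show "x = y" by (simp add: vec_eq_iff)
qed

text \<open>Functions on the embedded torus rather than on R^d, since Stone-Weierstrass asks for a
  compact space and for separation of its points.\<close>

definition trig_ring :: "(complex^'d::finite \<Rightarrow> real) set" where
  "trig_ring = {h. continuous_on (range unit_vec) h \<and> trig (\<lambda>x. of_real (h (unit_vec x)))}"

lemma cis_trig: "trig (\<lambda>x. of_real (Re (cis (x $ j))))" "trig (\<lambda>x. of_real (Im (cis (x $ j))))"
proof -
  have e: "char_exp (axis j s) x = cis (of_int s * x $ j)" for s x
    by (simp add: char_exp_def cis_conv_exp axis_def if_distrib[of "\<lambda>a. of_int a * _"]
        if_distrib[of of_int] if_distrib[of "\<lambda>a. a * _"] cong: if_cong)
  have "(\<lambda>x. of_real (Re (cis (x $ j)))) = (\<lambda>x. (1/2) * char_exp (axis j 1) x + (1/2) * char_exp (axis j (- 1)) x)"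
    by (auto simp: fun_eq_iff e complex_eq_iff)
  then show "trig (\<lambda>x. of_real (Re (cis (x $ j))))"
    by (simp only:) (intro trig_add trig_char)
  have "(\<lambda>x. of_real (Im (cis (x $ j)))) = (\<lambda>x. (- \<i>/2) * char_exp (axis j 1) x + (\<i>/2) * char_exp (axis j (- 1)) x)"
    by (auto simp: fun_eq_iff e complex_eq_iff)
  then show "trig (\<lambda>x. of_real (Im (cis (x $ j))))"
    by (simp only:) (intro trig_add trig_char)
qed

text \<open>Separation of points: two different points of the image differ in the real or imaginary
  part of some coordinate, and these pull back to the cosine and sine of one variable.\<close>

lemma trig_ring: "function_ring_on trig_ring (range unit_vec)"
proof
  show "compact (range unit_vec)" by (rule compact_range_unit_vec)
next
  fix z w :: "complex^'a" assume "z \<in> range unit_vec" "w \<in> range unit_vec" "z \<noteq> w"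
  then obtain j where "z $ j \<noteq> w $ j" by (auto simp: vec_eq_iff)
  then consider "Re (z $ j) \<noteq> Re (w $ j)" | "Im (z $ j) \<noteq> Im (w $ j)" by (auto simp: complex_eq_iff)
  moreover have mem: "(\<lambda>z. Re (z $ j)) \<in> trig_ring" "(\<lambda>z. Im (z $ j)) \<in> trig_ring"
    unfolding trig_ring_def using cis_trig[of j]
    by (auto simp: unit_vec_def intro!: continuous_intros)
  ultimately show "\<exists>f\<in>trig_ring. f z \<noteq> f w"
    by cases (rule bexI[OF _ mem(1)], simp, rule bexI[OF _ mem(2)], simp)
qed (auto simp: trig_ring_def trig_const intro!: continuous_intros trig_add trig_mult)

lemma approximable_continuous:
  fixes h :: "complex^'d::finite \<Rightarrow> real"
  assumes h: "continuous_on UNIV h"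
  shows "approximable (\<lambda>x. of_real (h (unit_vec x)))"
proof (rule approximable_close)
  have hu: "continuous_on UNIV (\<lambda>x. h (unit_vec x))"
    by (rule continuous_on_compose2[OF h continuous_unit_vec]) auto
  have "bounded (h ` range unit_vec)"
    by (intro compact_imp_bounded compact_continuous_image continuous_on_subset[OF h] compact_range_unit_vec) auto
  then obtain B where B: "\<And>x. \<bar>h (unit_vec x)\<bar> \<le> B" by (auto simp: bounded_iff)
  show sq: "sq_int (\<lambda>x. complex_of_real (h (unit_vec x)))"
    using B hu by (intro sq_int_bounded[of _ B]) (auto intro!: borel_measurable_continuous_onI continuous_intros)
  fix e :: real assume e: "e > 0"
  \<comment> \<open>A uniform error d gives a squared L2 error of at most d^2 because the total mass
    is one; halving e makes the bound strict.\<close>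
  define d where "d = sqrt (e / 2)"
  have d: "d > 0" "d\<^sup>2 < e" using e by (auto simp: d_def)
  obtain g where g: "g \<in> trig_ring" "\<And>x. \<bar>h (unit_vec x) - g (unit_vec x)\<bar> < d"
    using function_ring_on.Stone_Weierstrass_basic[OF trig_ring continuous_on_subset[OF h] d(1)] by blast
  have t: "trig (\<lambda>x. complex_of_real (g (unit_vec x)))" using g(1) by (simp add: trig_ring_def)
  have "(LINT x|torus_measure. (cmod (complex_of_real (h (unit_vec x)) - complex_of_real (g (unit_vec x))))\<^sup>2) \<le>
      (LINT x|(torus_measure :: (real^'d) measure). d\<^sup>2)"
  proof (rule integral_mono)
    show "integrable torus_measure (\<lambda>x. (cmod (complex_of_real (h (unit_vec x)) - complex_of_real (g (unit_vec x))))\<^sup>2)"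
      using sq_int_diff[OF sq sq_int_trig[OF t]] by (simp add: sq_int_def)
    fix x :: "real^'d"
    show "(cmod (complex_of_real (h (unit_vec x)) - complex_of_real (g (unit_vec x))))\<^sup>2 \<le> d\<^sup>2"
      using g(2)[of x] unfolding of_real_diff[symmetric] norm_of_real by (intro power_mono) auto
  qed simp
  also have "\<dots> = d\<^sup>2" by (simp add: measure_def emeasure_torus_UNIV)
  finally show "\<exists>G. approximable G \<and>
      (LINT x|torus_measure. (cmod (complex_of_real (h (unit_vec x)) - G x))\<^sup>2) < e"
    using approximable_trig[OF t] d(2) by (meson le_less_trans)
qed

section \<open>From compact sets to all square-integrable functions\<close>

lemma AE_torus_fund_cube: "AE x in torus_measure. x \<in> (fund_cube :: (real^'d::finite) set)"
  unfolding torus_measure_def using AE_fund_cube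
  by (subst AE_density) (auto elim!: eventually_mono split: split_indicator_asm)

lemma sq_int_indicator: "A \<in> sets borel \<Longrightarrow> sq_int (\<lambda>x. complex_of_real (indicator A x))"
  by (rule sq_int_bounded[of _ 1]) (auto split: split_indicator)

text \<open>The indicator is the limit of tent functions of the distance to the image of K, steeper
  as n grows. They are continuous on the torus and lie between 0 and 1. At points of the cube
  outside K they vanish eventually, because the image is closed and \<open>unit_vec\<close> is
  injective on the cube; dominated convergence does the rest.\<close>

lemma approximable_compact:
  fixes K :: "(real^'d::finite) set"
  assumes K: "compact K" "K \<subseteq> fund_cube"
  shows "approximable (\<lambda>x. of_real (indicator K x))"
proof (cases "K = {}")
  case True
  then show ?thesis using approximable_trig[OF trig_const[of 0]] by simp
next
  case False
  have Km [measurable]: "K \<in> sets borel" using K(1) by (simp add: borel_compact)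
  define C where "C = unit_vec ` K"
  have C: "closed C" "C \<noteq> {}"
    using False K(1) unfolding C_def
    by (auto intro!: compact_imp_closed compact_continuous_image continuous_on_subset[OF continuous_unit_vec])
  define h where "h n z = max 0 (1 - real n * infdist z C)" for n z
  have hc: "continuous_on UNIV (h n)" for n
    unfolding h_def[abs_def] by (intro continuous_intros)
  note app = approximable_continuous[OF hc]
  have lim: "(\<lambda>n. h n (unit_vec x)) \<longlonglongrightarrow> indicator K x" if x: "x \<in> fund_cube" for x
  proof (cases "x \<in> K")
    case True
    then have "unit_vec x \<in> C" by (simp add: C_def)
    then show ?thesis using True by (simp add: h_def)
  next
    case False
    then have "unit_vec x \<notin> C"
      unfolding C_def using inj_on_image_mem_iff[OF inj_unit_vec x K(2)] by simp
    then have pos: "infdist (unit_vec x) C > 0"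
      using C in_closed_iff_infdist_zero[OF C] infdist_nonneg[of "unit_vec x" C] by (simp add: less_le)
    then obtain N where N: "1 < real N * infdist (unit_vec x) C"
      using reals_Archimedean3 by blast
    have "h n (unit_vec x) = 0" if "n \<ge> N" for n
    proof -
      have "real N * infdist (unit_vec x) C \<le> real n * infdist (unit_vec x) C"
        using that pos by (intro mult_right_mono) auto
      then show ?thesis using N by (simp add: h_def)
    qed
    then have "eventually (\<lambda>n. h n (unit_vec x) = 0) sequentially"
      unfolding eventually_sequentially by blast
    then show ?thesis using False by (simp add: tendsto_eventually)
  qed
  have hm [measurable]: "(\<lambda>x. h n (unit_vec x)) \<in> borel_measurable borel" for n
    by (rule borel_measurable_continuous_onI, rule continuous_on_compose2[OF hc continuous_unit_vec]) auto
  have "(\<lambda>n. LINT x|torus_measure. (cmod (of_real (indicator K x) - of_real (h n (unit_vec x))))\<^sup>2)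
      \<longlonglongrightarrow> (LINT x|(torus_measure :: (real^'d) measure). 0)"
  proof (rule integral_dominated_convergence[where w = "\<lambda>_. 1"])
    show "AE x in torus_measure. (\<lambda>n. (cmod (of_real (indicator K x) - of_real (h n (unit_vec x))))\<^sup>2) \<longlonglongrightarrow> 0"
      using AE_torus_fund_cube
    proof eventually_elim
      case (elim x)
      have "(\<lambda>n. (indicator K x - h n (unit_vec x))\<^sup>2) \<longlonglongrightarrow> (indicator K x - indicator K x)\<^sup>2"
        by (intro tendsto_intros lim elim)
      then show ?case by (simp add: of_real_diff[symmetric] del: of_real_diff)
    qed
    have "\<bar>indicator K x - h n (unit_vec x)\<bar> \<le> 1" for n x
      using infdist_nonneg[of "unit_vec x" C] by (auto simp: h_def split: split_indicator)
    then have "(indicator K x - h n (unit_vec x))\<^sup>2 \<le> 1" for n x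
      by (simp add: abs_square_le_1)
    then show "AE x in torus_measure. norm ((cmod (of_real (indicator K x) - of_real (h n (unit_vec x))))\<^sup>2) \<le> 1" for n
      by (simp add: of_real_diff[symmetric] del: of_real_diff)
  qed auto
  then have lim0: "(\<lambda>n. LINT x|torus_measure. (cmod (of_real (indicator K x) - of_real (h n (unit_vec x))))\<^sup>2) \<longlonglongrightarrow> 0"
    by simp
  show ?thesis
  proof (rule approximable_close)
    show "sq_int (\<lambda>x. complex_of_real (indicator K x))" using Km by (rule sq_int_indicator)
    fix e :: real assume "e > 0"
    with lim0 have "eventually (\<lambda>n. (LINT x|torus_measure. (cmod (of_real (indicator K x) - of_real (h n (unit_vec x))))\<^sup>2) < e) sequentially"
      by (rule order_tendstoD(2))
    then obtain n where "(LINT x|torus_measure. (cmod (of_real (indicator K x) - of_real (h n (unit_vec x))))\<^sup>2) < e"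
      by (auto simp: eventually_sequentially)
    then show "\<exists>G. approximable G \<and> (LINT x|torus_measure. (cmod (complex_of_real (indicator K x) - G x))\<^sup>2) < e"
      using app[of n] by blast
  qed
qed

text \<open>Inner regularity of Lebesgue measure provides a closed subset of the part of A in the
  cube, compact because the cube is bounded. Dividing by (2 pi)^d \<ge> 1 cannot enlarge the measure
  of the difference.\<close>

lemma approximable_indicator:
  fixes A :: "(real^'d::finite) set"
  assumes A [measurable]: "A \<in> sets borel"
  shows "approximable (\<lambda>x. of_real (indicator A x))"
proof (rule approximable_close)
  show "sq_int (\<lambda>x. complex_of_real (indicator A x))" using A by (rule sq_int_indicator)
  fix e :: real assume e: "e > 0"
  have S [measurable]: "A \<inter> fund_cube \<in> sets borel" by measurable
  then have "A \<inter> fund_cube \<in> sets lebesgue" by simp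
  then obtain T where T: "closed T" "T \<subseteq> A \<inter> fund_cube" "emeasure lebesgue (A \<inter> fund_cube - T) < ennreal e"
    using e sets_lebesgue_inner_closed by metis
  have Tm [measurable]: "T \<in> sets borel" using T(1) by simp
  have "bounded T" using T(2) fund_cube_subset bounded_cbox unfolding torus_cube_def
    by (metis bounded_subset le_inf_iff)
  then have T': "compact T" "T \<subseteq> fund_cube" using T by (auto simp: compact_eq_bounded_closed)
  have "1 \<le> (2 * pi) ^ CARD('d)" using pi_gt3 by (intro one_le_power) auto
  then have le1: "1 / (2 * pi) ^ CARD('d) \<le> 1" by simp
  have "emeasure torus_measure (A - T) = ennreal (1 / (2 * pi) ^ CARD('d)) * emeasure lborel ((A - T) \<inter> fund_cube)"
    by (rule emeasure_torus_measure) measurable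
  also have "\<dots> \<le> 1 * emeasure lborel ((A - T) \<inter> fund_cube)"
    using le1 by (intro mult_right_mono) auto
  also have "\<dots> = emeasure lebesgue (A \<inter> fund_cube - T)"
    by (auto intro!: arg_cong[where f = "emeasure lborel"])
  also have "\<dots> < ennreal e" by (rule T)
  finally have lt: "measure torus_measure (A - T) < e"
    unfolding torus.emeasure_eq_measure by (subst (asm) ennreal_less_iff) auto
  have "(cmod (complex_of_real (indicator A x) - complex_of_real (indicator T x)))\<^sup>2 = indicator (A - T) x" for x
    using T(2) by (auto split: split_indicator)
  then have "(LINT x|torus_measure. (cmod (complex_of_real (indicator A x) - complex_of_real (indicator T x)))\<^sup>2)
      = measure torus_measure (A - T)" by simp
  with lt approximable_compact[OF T'] 
  show "\<exists>G. approximable G \<and> (LINT x|torus_measure. (cmod (complex_of_real (indicator A x) - G x))\<^sup>2) < e"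
    by metis
qed

text \<open>Square integrability takes part in the induction, since the claim includes it for u;
  each case must therefore hand it down to the pieces, by rescaling or by domination.\<close>

lemma approximable_nonneg:
  fixes u :: "real^'d::finite \<Rightarrow> real"
  assumes "u \<in> borel_measurable torus_measure" "\<And>x. 0 \<le> u x" "integrable torus_measure (\<lambda>x. (u x)\<^sup>2)"
  shows "approximable (\<lambda>x. of_real (u x))"
  using assms
proof (induction rule: borel_measurable_induct_real)
  case (set A)
  then show ?case by (simp add: approximable_indicator)
next
  case (mult u c)
  show ?case
  proof (cases "c = 0")
    case True
    then show ?thesis using approximable_trig[OF trig_const[of 0]] by simp
  next
    case False
    have "integrable torus_measure (\<lambda>x. (1 / c\<^sup>2) * (c * u x)\<^sup>2)" using mult by (intro integrable_mult_right) auto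
    moreover have "(1 / c\<^sup>2) * (c * u x)\<^sup>2 = (u x)\<^sup>2" for x using False by (simp add: power_mult_distrib)
    ultimately have "integrable torus_measure (\<lambda>x. (u x)\<^sup>2)" by (simp only:)
    then have "approximable (\<lambda>x. complex_of_real (u x))" by (rule mult.IH)
    then show ?thesis using approximable_mult[of "\<lambda>x. complex_of_real (u x)" "of_real c"] by simp
  qed
next
  case (add u v)
  note [measurable] = add.hyps(1) add.hyps(3)
  have "(u x)\<^sup>2 \<le> (v x + u x)\<^sup>2" "(v x)\<^sup>2 \<le> (v x + u x)\<^sup>2" for x
    using add.hyps(2,4)[of x] by (auto intro!: power_mono)
  then have "integrable torus_measure (\<lambda>x. (u x)\<^sup>2)" "integrable torus_measure (\<lambda>x. (v x)\<^sup>2)"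
    by (auto intro!: Bochner_Integration.integrable_bound[OF add.prems])
  then show ?case using approximable_add[OF add.IH(2) add.IH(1)] by simp
next
  case (seq U)
  note [measurable] = seq.hyps(1) assms(1)
  have Uu: "U i x \<le> u x" for i x
    using seq.hyps(4,3) by (intro incseq_le[of "\<lambda>i. U i x"]) (auto simp: incseq_def le_fun_def)
  have u0: "0 \<le> u x" for x using Uu[of 0 x] seq.hyps(2)[of 0 x] by linarith
  have "(U i x)\<^sup>2 \<le> (u x)\<^sup>2" for i x using Uu seq.hyps(2) by (intro power_mono)
  then have int: "integrable torus_measure (\<lambda>x. (U i x)\<^sup>2)" for i
    by (auto intro!: Bochner_Integration.integrable_bound[OF seq.prems])
  note app = seq.IH[OF int]
  have "(\<lambda>n. LINT x|torus_measure. (cmod (of_real (u x) - of_real (U n x)))\<^sup>2)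
      \<longlonglongrightarrow> (LINT x|(torus_measure :: (real^'d) measure). 0)"
  proof (rule integral_dominated_convergence[where w = "\<lambda>x. (u x)\<^sup>2"])
    show "AE x in torus_measure. (\<lambda>n. (cmod (of_real (u x) - of_real (U n x)))\<^sup>2) \<longlonglongrightarrow> 0"
    proof (rule AE_I2)
      fix x :: "real^'d" 
      have "(\<lambda>n. (u x - U n x)\<^sup>2) \<longlonglongrightarrow> (u x - u x)\<^sup>2"
        by (intro tendsto_intros seq) simp
      then show "(\<lambda>n. (cmod (of_real (u x) - of_real (U n x)))\<^sup>2) \<longlonglongrightarrow> 0"
        by (simp add: of_real_diff[symmetric] del: of_real_diff)
    qed
    \<comment> \<open>The \<open>U n\<close> are nonnegative and increase to u, so the difference
      lies between 0 and u.\<close>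
    have "(u x - U n x)\<^sup>2 \<le> (u x)\<^sup>2" for n x
      using Uu seq.hyps(2) by (intro power_mono) auto
    then show "AE x in torus_measure. norm ((cmod (of_real (u x) - of_real (U n x)))\<^sup>2) \<le> (u x)\<^sup>2" for n
      by (simp add: of_real_diff[symmetric] del: of_real_diff)
  qed (use seq.prems in auto)
  then have lim0: "(\<lambda>n. LINT x|torus_measure. (cmod (of_real (u x) - of_real (U n x)))\<^sup>2) \<longlonglongrightarrow> 0"
    by simp
  show ?case
  proof (rule approximable_close)
    show "sq_int (\<lambda>x. complex_of_real (u x))"
      using seq.prems assms(1) by (auto simp: sq_int_def)
    fix e :: real assume "e > 0"
    with lim0 have "eventually (\<lambda>n. (LINT x|torus_measure. (cmod (of_real (u x) - of_real (U n x)))\<^sup>2) < e) sequentially"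
      by (rule order_tendstoD(2))
    then obtain n where "(LINT x|torus_measure. (cmod (of_real (u x) - of_real (U n x)))\<^sup>2) < e"
      by (auto simp: eventually_sequentially)
    then show "\<exists>G. approximable G \<and> (LINT x|torus_measure. (cmod (complex_of_real (u x) - G x))\<^sup>2) < e"
      using app[of n] by blast
  qed
qed

lemma approximable_sq_int:
  assumes F: "sq_int F" shows "approximable F"
proof -
  note [measurable] = sq_int_measurable[OF F]
  have part: "approximable (\<lambda>x. of_real (u x))"
    if [measurable]: "u \<in> borel_measurable borel" and u: "\<And>x. 0 \<le> u x" "\<And>x. u x \<le> cmod (F x)" for u
  proof (rule approximable_nonneg)
    have "norm ((u x)\<^sup>2) \<le> (cmod (F x))\<^sup>2" for x using u by (auto intro!: power_mono)
    then show "integrable torus_measure (\<lambda>x. (u x)\<^sup>2)"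
      using F by (intro Bochner_Integration.integrable_bound[of torus_measure "\<lambda>x. (cmod (F x))\<^sup>2" "\<lambda>x. (u x)\<^sup>2"])
        (auto simp: sq_int_def)
  qed (use u in auto)
  have bound: "max 0 (s * Re z) \<le> cmod z" "max 0 (s * Im z) \<le> cmod z" if "s = 1 \<or> s = - 1" for s z
    using that abs_Re_le_cmod[of z] abs_Im_le_cmod[of z] by auto
  \<comment> \<open>The factors 1 give all four summands the same shape, so that
    \<open>part\<close>, \<open>bound\<close> and \<open>approximable_mult\<close> apply uniformly
    to the positive and negative parts.\<close>
  have "approximable (\<lambda>x. ((1 * of_real (max 0 (1 * Re (F x))) + (- 1) * of_real (max 0 ((- 1) * Re (F x))))
      + \<i> * of_real (max 0 (1 * Im (F x)))) + (- \<i>) * of_real (max 0 ((- 1) * Im (F x))))"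
    by (intro approximable_add approximable_mult part bound) auto
  also have "(\<lambda>x. ((1 * of_real (max 0 (1 * Re (F x))) + (- 1) * of_real (max 0 ((- 1) * Re (F x))))
      + \<i> * of_real (max 0 (1 * Im (F x)))) + (- \<i>) * of_real (max 0 ((- 1) * Im (F x)))) = F"
    by (auto simp: fun_eq_iff complex_eq_iff max_def)
  finally show ?thesis .
qed

text \<open>
  The half of Parseval's identity that needs completeness, stated with finite sums so that the
  convergence of the series never has to be discussed.
\<close>
lemma Parseval_le:
  assumes F: "sq_int F" and B: "\<And>K. finite K \<Longrightarrow> (\<Sum>k\<in>K. (cmod (coef F k))\<^sup>2) \<le> B"
  shows "(LINT x|torus_measure. (cmod (F x))\<^sup>2) \<le> B"
proof (rule field_le_epsilon)
  fix e :: real assume "e > 0"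
  with approximable_sq_int[OF F] obtain p where "trig p" and
    p: "(LINT x|torus_measure. (cmod (F x - p x))\<^sup>2) < e"
    unfolding approximable_def by blast
  then obtain K c where K: "finite K" "p = (\<lambda>x. \<Sum>k\<in>K. c k * char_exp k x)"
    using trig_sumE by metis
  \<comment> \<open>Solved for the norm of F, \<open>norm_diff_trig\<close> contains this sum with a
    minus sign, so it may be dropped although c need not consist of coefficients of F.\<close>
  have "0 \<le> (\<Sum>k\<in>K. (cmod (coef F k - c k))\<^sup>2)" by (simp add: sum_nonneg)
  then show "(LINT x|torus_measure. (cmod (F x))\<^sup>2) \<le> B + e"
    using p B[OF K(1)] norm_diff_trig[OF F K(1), of c] unfolding K(2) by linarith
qed

subsection \<open>Convolution and aliasing\<close>

lemma L2_norm_eq: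
  fixes f :: "real^'d::finite \<Rightarrow> 'b::{real_normed_vector, second_countable_topology}"
  assumes [measurable]: "f \<in> borel_measurable borel"
  shows "L2_norm f = sqrt (LINT x|torus_measure. (norm (f x))\<^sup>2)"
  unfolding L2_norm_def by (subst integral_torus_measure) (auto simp: divide_inverse mult.commute)

lemma torus_conv_eq:
  fixes f g :: "real^'d::finite \<Rightarrow> 'b::{real_normed_field, banach, second_countable_topology}"
  assumes [measurable]: "f \<in> borel_measurable borel" "g \<in> borel_measurable borel"
  shows "torus_conv f g x = (LINT y|torus_measure. f y * g (x - y))"
  unfolding torus_conv_def by (subst integral_torus_measure) auto

lemma L2_torusD:
  assumes "g \<in> L2_torus"
  shows "torus_periodic g" "g \<in> borel_measurable borel"
    "sq_int (\<lambda>x. complex_of_real (g x))" "torus_periodic (\<lambda>x. complex_of_real (g x))"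
proof -
  have g: "torus_periodic g" "g \<in> borel_measurable borel" "set_integrable lborel torus_cube (\<lambda>x. (g x)\<^sup>2)"
    using assms by (simp_all add: L2_torus_def)
  show "torus_periodic g" "g \<in> borel_measurable borel" by fact+
  note [measurable] = g(2)
  have "integrable torus_measure (\<lambda>x. (g x)\<^sup>2)"
    using g(3) by (subst integrable_torus_measure) auto
  then show "sq_int (\<lambda>x. complex_of_real (g x))" by (simp add: sq_int_def)
  show "torus_periodic (\<lambda>x. complex_of_real (g x))" using g(1) by (simp add: torus_periodic_def)
qed

text \<open>Testing against the smooth conjugate character of frequency k leaves a single term of
  the series; the factor (2 pi)^d of the unnormalised pairing occurs on both sides and
  cancels.\<close>

lemma coef_distributional:
  fixes \<phi> :: "real^'d::finite \<Rightarrow> real"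
  assumes \<phi>: "\<phi> \<in> L2_torus" and d: "distributional_series \<phi> c"
  shows "coef (\<lambda>x. complex_of_real (\<phi> x)) k = c k"
proof -
  note [measurable] = L2_torusD(2)[OF \<phi>]
  let ?P = "(2 * pi) ^ CARD('d)"
  have "((\<lambda>l. c l * (LINT x:torus_cube|lborel. char_exp l x * char_exp (- k) x)) has_sum
        (LINT x:torus_cube|lborel. of_real (\<phi> x) * char_exp (- k) x)) UNIV"
    using d test_function_char_exp unfolding distributional_series_def by blast
  moreover have "(LINT x:torus_cube|lborel. char_exp l x * char_exp (- k) x) = (if l = k then of_real ?P else 0)" for l
  proof -
    have "(LINT x|torus_measure. char_exp l x * char_exp (- k) x) = (if l = k then 1 else 0)"
      by (simp add: char_exp_add[symmetric] integral_char_exp)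
    then show ?thesis by (subst (asm) integral_torus_measure) (auto simp: scaleR_conv_of_real field_simps split: if_splits)
  qed
  moreover have "(LINT x:torus_cube|lborel. of_real (\<phi> x) * char_exp (- k) x) =
      of_real ?P * coef (\<lambda>x. complex_of_real (\<phi> x)) k"
  proof -
    have "coef (\<lambda>x. complex_of_real (\<phi> x)) k = (LINT x:torus_cube|lborel. of_real (\<phi> x) * char_exp (- k) x) /\<^sub>R ?P"
      unfolding coef_def by (rule integral_torus_measure) measurable
    then have "?P *\<^sub>R coef (\<lambda>x. complex_of_real (\<phi> x)) k = (LINT x:torus_cube|lborel. of_real (\<phi> x) * char_exp (- k) x)"
      using pi_gt_zero by (simp only: scaleR_scaleR) (subst right_inverse, auto)
    then show ?thesis by (simp add: scaleR_conv_of_real)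
  qed
  ultimately have "((\<lambda>l. c l * (if l = k then of_real ?P else 0)) has_sum
      (of_real ?P * coef (\<lambda>x. complex_of_real (\<phi> x)) k)) UNIV" by simp
  moreover have "((\<lambda>l. c l * (if l = k then of_real ?P else 0)) has_sum (of_real ?P * c k)) UNIV"
    by (rule has_sum_finite_neutralI[of "{k}"]) (auto simp: mult.commute)
  ultimately have "of_real ?P * coef (\<lambda>x. complex_of_real (\<phi> x)) k = of_real ?P * c k"
    by (rule has_sum_unique)
  then show ?thesis by simp
qed

lemma sq_int_integrable:
  assumes "sq_int F" shows "integrable torus_measure F"
  using integrable_coef[OF assms, of 0] by simp

lemma periodic_mult_char_exp: "torus_periodic F \<Longrightarrow> torus_periodic (\<lambda>x. F x * char_exp k x)"
  using periodic_char_exp[of k] by (simp add: torus_periodic_def)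

lemma sq_int_translate:
  assumes F: "sq_int F" and p: "torus_periodic F"
  shows "sq_int (\<lambda>x. F (x - t))"
proof -
  note [measurable] = sq_int_measurable[OF F]
  have "torus_periodic (\<lambda>x. (cmod (F x))\<^sup>2)" using p by (simp add: torus_periodic_def)
  from torus_shift(1)[OF this, of 1 "- t"] show ?thesis using F by (simp add: sq_int_def)
qed

lemma coef_translate:
  assumes F: "F \<in> borel_measurable borel" and p: "torus_periodic F"
  shows "coef (\<lambda>x. F (x - t)) k = char_exp (- k) t * coef F k"
proof -
  note [measurable] = F
  have "coef (\<lambda>x. F (x - t)) k = (LINT x|torus_measure. char_exp (- k) t * (F (- t + 1 *\<^sub>R x) * char_exp (- k) (- t + 1 *\<^sub>R x)))"
    unfolding coef_def
  proof (intro Bochner_Integration.integral_cong refl)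
    fix x
    have "char_exp (- k) x = char_exp (- k) t * char_exp (- k) (- t + x)"
      by (simp add: char_exp_add_arg[symmetric])
    then show "F (x - t) * char_exp (- k) x = char_exp (- k) t * (F (- t + 1 *\<^sub>R x) * char_exp (- k) (- t + 1 *\<^sub>R x))"
      by simp
  qed
  also have "\<dots> = char_exp (- k) t * (LINT x|torus_measure. (F (- t + 1 *\<^sub>R x) * char_exp (- k) (- t + 1 *\<^sub>R x)))"
    by simp
  also have "(LINT x|torus_measure. (F (- t + 1 *\<^sub>R x) * char_exp (- k) (- t + 1 *\<^sub>R x))) = coef F k"
    unfolding coef_def by (rule torus_shift(2)[OF periodic_mult_char_exp[OF p]]) auto
  finally show ?thesis .
qed

text \<open>Characters are eigenfunctions of convolution with F: the character k at y is the
  character k at x times the character - k at x - y, and the reflection y -> x - y preserves the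
  measure.\<close>

lemma char_exp_conv:
  assumes F: "F \<in> borel_measurable borel" and p: "torus_periodic F"
  shows "(LINT y|torus_measure. char_exp k y * F (x - y)) = coef F k * char_exp k x"
proof -
  note [measurable] = F
  have "(LINT y|torus_measure. char_exp k y * F (x - y)) =
    (LINT y|torus_measure. char_exp k x * (F (x + (- 1) *\<^sub>R y) * char_exp (- k) (x + (- 1) *\<^sub>R y)))"
  proof (intro Bochner_Integration.integral_cong refl)
    fix y
    have "char_exp k y = char_exp k (x + (y - x))" by simp
    also have "\<dots> = char_exp k x * char_exp (- k) (x - y)"
      by (simp only: char_exp_add_arg char_exp_minus_arg[symmetric] minus_diff_eq)
    finally show "char_exp k y * F (x - y) = char_exp k x * (F (x + (- 1) *\<^sub>R y) * char_exp (- k) (x + (- 1) *\<^sub>R y))"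
      by simp
  qed
  also have "\<dots> = char_exp k x * (LINT y|torus_measure. F (x + (- 1) *\<^sub>R y) * char_exp (- k) (x + (- 1) *\<^sub>R y))"
    by simp
  also have "(LINT y|torus_measure. F (x + (- 1) *\<^sub>R y) * char_exp (- k) (x + (- 1) *\<^sub>R y)) = coef F k"
    unfolding coef_def by (rule torus_shift(2)[OF periodic_mult_char_exp[OF p]]) auto
  finally show ?thesis by (simp add: mult.commute)
qed

text \<open>Fubini, with translation removing y from the inner integral. The interchange is
  legitimate because the L1 norm of a translate of G does not depend on the translation, so the
  iterated integral of the absolute value is a product of two L1 norms.\<close>

lemma coef_conv:
  fixes F G :: "real^'d::finite \<Rightarrow> complex"
  assumes F: "sq_int F" and G: "sq_int G" and p: "torus_periodic G"
  shows "coef (\<lambda>x. LINT y|torus_measure. F y * G (x - y)) k = coef F k * coef G k"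
proof -
  note [measurable] = sq_int_measurable[OF F] sq_int_measurable[OF G]
  interpret PP: pair_sigma_finite "torus_measure :: (real^'d) measure" "torus_measure :: (real^'d) measure"
    by standard
  define f where "f y x = F y * G (x - y) * char_exp (- k) x" for y x
  have "integrable torus_measure (\<lambda>x. cmod (G (- y + 1 *\<^sub>R x)))"
    and *: "(LINT x|torus_measure. cmod (G (- y + 1 *\<^sub>R x))) = (LINT x|torus_measure. cmod (G x))" for y
    using torus_shift[of "\<lambda>x. cmod (G x)" 1 "- y"] p sq_int_integrable[OF G]
    by (auto simp: torus_periodic_def)
  have "(LINT x|torus_measure. cmod (f y x)) = cmod (F y) * (LINT x|torus_measure. cmod (G (- y + 1 *\<^sub>R x)))" for y
    by (simp add: f_def norm_mult)
  then have nf: "(LINT x|torus_measure. cmod (f y x)) = cmod (F y) * (LINT x|torus_measure. cmod (G x))" for y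
    by (simp only: *)
  have "integrable (torus_measure \<Otimes>\<^sub>M torus_measure) (case_prod f)"
  proof (rule PP.Fubini_integrable)
    show "case_prod f \<in> borel_measurable (torus_measure \<Otimes>\<^sub>M torus_measure)"
      unfolding f_def by measurable
    show "integrable torus_measure (\<lambda>y. LINT x|torus_measure. cmod (case (y, x) of (y, x) \<Rightarrow> f y x))"
      using sq_int_integrable[OF F] by (simp add: nf)
    have "integrable torus_measure (f y)" for y
      using integrable_coef[OF sq_int_mult[OF sq_int_translate[OF G p]], of "F y" y "- k"]
      unfolding f_def by simp
    then show "AE y in torus_measure. integrable torus_measure (\<lambda>x. case (y, x) of (y, x) \<Rightarrow> f y x)" by simp
  qed
  then have "(LINT x|torus_measure. LINT y|torus_measure. f y x) = (LINT y|torus_measure. LINT x|torus_measure. f y x)"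
    by (rule PP.Fubini_integral)
  moreover have "(LINT x|torus_measure. f y x) = coef G k * (F y * char_exp (- k) y)" for y
  proof -
    have "(LINT x|torus_measure. f y x) = F y * coef (\<lambda>x. G (x - y)) k"
      unfolding coef_def f_def by (simp add: mult.assoc)
    then show ?thesis by (simp add: coef_translate p)
  qed
  moreover have "(LINT x|torus_measure. LINT y|torus_measure. f y x) =
      coef (\<lambda>x. LINT y|torus_measure. F y * G (x - y)) k"
    by (simp add: f_def coef_def)
  ultimately show ?thesis by (simp add: coef_def)
qed

text \<open>Coefficients are integrals, so the almost everywhere equality that defines a generator
  is enough.\<close>

lemma coef_Phi:
  fixes f g \<phi> :: "real^'d::finite \<Rightarrow> real"
  assumes f: "f \<in> L2_torus" and \<phi>: "\<phi> \<in> L2_torus" and g: "is_generator \<phi> f g"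
  shows "coef (\<lambda>x. complex_of_real (f x)) k =
    coef (\<lambda>x. complex_of_real (\<phi> x)) k * coef (\<lambda>x. complex_of_real (g x)) k"
proof -
  have gL: "g \<in> L2_torus" using g by (simp add: is_generator_def)
  note [measurable] = L2_torusD(2)[OF f] L2_torusD(2)[OF \<phi>] L2_torusD(2)[OF gL]
  have "coef (\<lambda>x. complex_of_real (f x)) k =
    coef (\<lambda>x. LINT y|torus_measure. complex_of_real (\<phi> y) * complex_of_real (g (x - y))) k"
    unfolding coef_def
  proof (rule integral_cong_AE)
    have "AE x in torus_measure. f x = torus_conv \<phi> g x"
      using g by (intro AE_torus_measure) (simp add: is_generator_def)
    then show "AE x in torus_measure. complex_of_real (f x) * char_exp (- k) x =
       (LINT y|torus_measure. complex_of_real (\<phi> y) * complex_of_real (g (x - y))) * char_exp (- k) x"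
      by eventually_elim (simp add: torus_conv_eq flip: of_real_mult)
  qed measurable
  then show ?thesis
    using coef_conv[OF L2_torusD(3)[OF \<phi>] L2_torusD(3,4)[OF gL], of k] by simp
qed

section \<open>Residues modulo 2m + 1 and character sums over the grid\<close>

lemma linf_le_iff: "linf k \<le> i \<longleftrightarrow> (\<forall>j. \<bar>k $ j\<bar> \<le> i)"
  by (auto simp: linf_def)

lemma finite_vec_Pi:
  assumes "finite A" shows "finite {l :: 'a^'d::finite. \<forall>j. l $ j \<in> A}"
    and "card {l :: 'a^'d::finite. \<forall>j. l $ j \<in> A} = card A ^ CARD('d)"
proof -
  have b: "bij_betw vec_lambda (PiE (UNIV :: 'd set) (\<lambda>_. A)) {l :: 'a^'d. \<forall>j. l $ j \<in> A}"
    by (rule bij_betw_byWitness[of _ vec_nth]) (auto simp: PiE_def extensional_def vec_lambda_inverse)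
  show "finite {l :: 'a^'d::finite. \<forall>j. l $ j \<in> A}"
    using bij_betw_finite[OF b] assms by (simp add: finite_PiE)
  show "card {l :: 'a^'d::finite. \<forall>j. l $ j \<in> A} = card A ^ CARD('d)"
    using bij_betw_same_card[OF b] by (simp add: card_PiE)
qed

lemma finite_linf_le: "finite {k :: int^'d::finite. linf k \<le> i}"
proof -
  have "{k :: int^'d. linf k \<le> i} = {k. \<forall>j. k $ j \<in> {- i..i}}" by (auto simp: linf_le_iff abs_le_iff) (metis minus_le_iff)+
  then show ?thesis using finite_vec_Pi(1)[of "{- i..i}"] by simp
qed

definition grid :: "nat \<Rightarrow> (nat^'d::finite) set" where
  "grid m = {l. \<forall>j. l $ j \<le> 2 * m}"

lemma finite_grid: "finite (grid m :: (nat^'d::finite) set)"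
  and card_grid: "card (grid m :: (nat^'d::finite) set) = (2 * m + 1) ^ CARD('d)"
  using finite_vec_Pi[of "{..2 * m}", where 'd = 'd] by (simp_all add: grid_def)

text \<open>Adding m moves the symmetric range [-m, m] to [0, 2m], where the residue is an ordinary
  \<open>mod\<close>.\<close>

lemma residue_vec_eq:
  "residue_vec m k = (\<chi> j. (k $ j + int m) mod (2 * int m + 1) - int m)"
  unfolding residue_vec_def
proof (rule the_equality)
  let ?N = "2 * int m + 1"
  have "\<bar>(a + int m) mod ?N - int m\<bar> \<le> int m" for a
    using pos_mod_bound[of ?N "a + int m"] pos_mod_sign[of ?N "a + int m"] by (simp add: abs_le_iff)
  moreover have "?N dvd a - ((a + int m) mod ?N - int m)" for a
    by (metis (no_types, lifting) add.commute add_diff_eq diff_diff_eq2 dvd_minus_mod)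
  ultimately show "linf (\<chi> j. (k $ j + int m) mod ?N - int m) \<le> int m \<and>
      (\<forall>j. ?N dvd k $ j - (\<chi> j. (k $ j + int m) mod ?N - int m) $ j)"
    by (simp add: linf_le_iff)
  fix k' assume k': "linf k' \<le> int m \<and> (\<forall>j. ?N dvd k $ j - k' $ j)"
  have "k' $ j = (k $ j + int m) mod ?N - int m" for j
  proof -
    have "\<bar>k' $ j\<bar> \<le> int m" "?N dvd (k $ j + int m) - (k' $ j + int m)" using k' by (auto simp: linf_le_iff)
    then have "(k $ j + int m) mod ?N = (k' $ j + int m) mod ?N" by (intro mod_eq_dvd_iff[THEN iffD2])
    also have "\<dots> = k' $ j + int m" using \<open>\<bar>k' $ j\<bar> \<le> int m\<close> by (intro mod_pos_pos_trivial) auto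
    finally show ?thesis by simp
  qed
  then show "k' = (\<chi> j. (k $ j + int m) mod ?N - int m)" by (simp add: vec_eq_iff)
qed

lemma residue_vec_linf: "linf (residue_vec m k) \<le> int m"
  unfolding linf_le_iff residue_vec_eq
  using pos_mod_bound[of "2 * int m + 1"] pos_mod_sign[of "2 * int m + 1"]
  by (force simp: abs_le_iff)

text \<open>Stated for k' - k since that is the frequency left over in \<open>coef_Q_op\<close> once
  the phases of V_m(g) and of the shifted \<psi> are multiplied.\<close>

lemma residue_vec_unique:
  assumes "linf k' \<le> int m"
  shows "(\<forall>j. (2 * int m + 1) dvd k' $ j - k $ j) \<longleftrightarrow> k' = residue_vec m k"
proof -
  have b: "\<bar>k' $ j\<bar> \<le> int m" for j using assms by (simp add: linf_le_iff)
  have "(2 * int m + 1) dvd k' $ j - k $ j \<longleftrightarrow> k' $ j = residue_vec m k $ j" for j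
  proof -
    have "(2 * int m + 1) dvd k' $ j - k $ j \<longleftrightarrow>
        (k' $ j + int m) mod (2 * int m + 1) = (k $ j + int m) mod (2 * int m + 1)"
      by (simp add: mod_eq_dvd_iff)
    also have "(k' $ j + int m) mod (2 * int m + 1) = k' $ j + int m"
      using b[of j] by (intro mod_pos_pos_trivial) auto
    finally show ?thesis by (auto simp: residue_vec_eq)
  qed
  then show ?thesis by (simp add: vec_eq_iff)
qed

lemma residue_vec_same: "linf k \<le> int m \<Longrightarrow> residue_vec m k = k"
  using residue_vec_unique[of k m k] by simp

text \<open>The vector j of k = k' + (2m + 1) j; the same shift by m as in
  \<open>residue_vec_eq\<close> makes quotient and remainder match.\<close>

definition quot_vec :: "nat \<Rightarrow> int^'d::finite \<Rightarrow> int^'d" where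
  "quot_vec m k = (\<chi> j. (k $ j + int m) div (2 * int m + 1))"

lemma residue_quot: "(\<chi> i. residue_vec m k $ i + (2 * int m + 1) * quot_vec m k $ i) = k"
  by (simp add: vec_eq_iff residue_vec_eq quot_vec_def) (smt (verit) mod_mult_div_eq)

lemma quot_vec_pos:
  assumes "\<not> linf k \<le> int m" shows "linf (quot_vec m k) > 0"
proof (rule ccontr)
  assume "\<not> linf (quot_vec m k) > 0"
  then have "quot_vec m k = 0" by (simp add: linf_le_iff not_less vec_eq_iff)
  then have "k = residue_vec m k" using residue_quot[of m k] by simp
  then show False using assms residue_vec_linf by metis
qed

text \<open>Discrete orthogonality, the source of aliasing: two frequencies congruent modulo 2m + 1
  in every coordinate cannot be told apart on the grid.\<close>

lemma sum_char_exp_grid: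
  fixes k :: "int^'d::finite"
  shows "(\<Sum>l\<in>grid m. char_exp k (grid_point m l)) =
    (if \<forall>j. (2 * int m + 1) dvd k $ j then of_nat ((2 * m + 1) ^ CARD('d)) else 0)"
proof -
  let ?N = "2 * m + 1"
  have point: "char_exp k (grid_point m l) = (\<Prod>j\<in>UNIV. cis (2 * pi * of_int (k $ j) * real (l $ j) / real ?N))" for l
  proof -
    have "char_exp k (grid_point m l) = cis (\<Sum>j\<in>UNIV. of_int (k $ j) * (2 * pi / real ?N * real (l $ j)))"
      by (simp add: char_exp_def grid_point_def cis_conv_exp)
    also have "\<dots> = (\<Prod>j\<in>UNIV. cis (of_int (k $ j) * (2 * pi / real ?N * real (l $ j))))"
      by (simp add: cis_conv_exp sum_distrib_left exp_sum)
    finally show ?thesis by (simp add: mult_ac)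
  qed
  show ?thesis
  proof (cases "\<forall>j. (2 * int m + 1) dvd k $ j")
    case True
    have "cis (2 * pi * of_int (k $ j) * real (l $ j) / real ?N) = 1" for j and l :: "nat^'d"
    proof -
      obtain q where q: "k $ j = (2 * int m + 1) * q" using True by (auto elim: dvdE)
      have "2 * pi * of_int (k $ j) * real (l $ j) / real ?N = 2 * pi * of_int (q * int (l $ j))"
        by (simp add: q field_simps)
      then show ?thesis by (simp only: cis_multiple_2pi[OF Ints_of_int])
    qed
    then show ?thesis using True card_grid[of m, where 'd = 'd] by (simp add: point)
  next
    case False
    then obtain i where i: "\<not> (2 * int m + 1) dvd k $ i" by blast
    txt \<open>
      The cyclic shift \<open>s\<close> in coordinate \<open>i\<close> permutes the grid and multiplies every term by the
      root of unity \<open>\<omega> \<noteq> 1\<close>, so the sum vanishes.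
    \<close>
    define s where "s l = (\<chi> j. if j = i then (l $ j + 1) mod ?N else l $ j)" for l :: "nat^'d"
    define \<omega> where "\<omega> = cis (2 * pi * of_int (k $ i) / real ?N)"
    have "\<omega> \<noteq> 1"
    proof
      assume "\<omega> = 1"
      then have "sin (2 * pi * of_int (k $ i) / real ?N) = sin 0 \<and> cos (2 * pi * of_int (k $ i) / real ?N) = cos 0"
        by (simp add: \<omega>_def complex_eq_iff)
      then obtain n where "2 * pi * of_int (k $ i) / real ?N = 2 * pi * of_int n"
        by (subst (asm) sin_cos_eq_iff) auto
      then have "2 * pi * (of_int (k $ i) / real ?N) = 2 * pi * of_int n" by simp
      then have "of_int (k $ i) / real ?N = of_int n" by (subst (asm) mult_cancel_left) auto
      then have "real_of_int (k $ i) = real_of_int ((2 * int m + 1) * n)" by (simp add: field_simps)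
      then have "k $ i = (2 * int m + 1) * n" by (simp only: of_int_eq_iff)
      then show False using i by simp
    qed
    have lt: "l $ j < ?N" if "l \<in> grid m" for l :: "nat^'d" and j
      using that by (auto simp: grid_def less_Suc_eq_le)
    have "inj_on s (grid m)"
    proof (rule inj_onI)
      fix l l' assume l: "l \<in> grid m" "l' \<in> grid m" "s l = s l'"
      have "l $ j = l' $ j" for j
      proof (cases "j = i")
        case True
        have "(l $ i + 1) mod ?N = (l' $ i + 1) mod ?N"
          using l(3) by (auto simp: s_def vec_eq_iff split: if_splits)
        then show ?thesis using lt[OF l(1), of i] lt[OF l(2), of i] True
          by (auto simp: mod_Suc split: if_splits)
      next
        case False
        then show ?thesis using l(3) by (auto simp: s_def vec_eq_iff split: if_splits)
      qed
      then show "l = l'" by (simp add: vec_eq_iff)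
    qed
    moreover have "s ` grid m \<subseteq> grid m"
      by (auto simp: s_def grid_def less_Suc_eq_le[symmetric])
    ultimately have bij: "bij_betw s (grid m) (grid m)"
      using endo_inj_surj[OF finite_grid[of m, where 'd = 'd]] by (simp add: bij_betw_def)
    have step: "char_exp k (grid_point m (s l)) = \<omega> * char_exp k (grid_point m l)" for l
    proof -
      have "cis (2 * pi * of_int (k $ i) * real ((l $ i + 1) mod ?N) / real ?N) =
          \<omega> * cis (2 * pi * of_int (k $ i) * real (l $ i) / real ?N)"
      proof -
        \<comment> \<open>Division with remainder absorbs the wrap-around of the cyclic shift: the
          quotient part contributes an integer number of full turns.\<close>
        have "real (l $ i + 1) = real ((l $ i + 1) mod ?N) + real ?N * real ((l $ i + 1) div ?N)"
          unfolding of_nat_mult[symmetric] of_nat_add[symmetric] by (simp only: mod_mult_div_eq)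
        moreover have "2 * pi * a / n + 2 * pi * a * b / n = 2 * pi * a * r / n + 2 * pi * (a * q)"
          if "b + 1 = r + n * q" "n \<noteq> 0" for a b n r q :: real
        proof -
          have "2 * pi * a / n + 2 * pi * a * b / n = 2 * pi * a * (b + 1) / n"
            by (simp add: add_divide_distrib ring_distribs)
          then show ?thesis unfolding that(1) using that(2) by (simp add: field_simps)
        qed
        ultimately have "2 * pi * of_int (k $ i) / real ?N + 2 * pi * of_int (k $ i) * real (l $ i) / real ?N =
          2 * pi * of_int (k $ i) * real ((l $ i + 1) mod ?N) / real ?N + 2 * pi * of_int (k $ i * int ((l $ i + 1) div ?N))"
          by (simp only: of_nat_add of_nat_1 of_int_mult of_int_of_nat_eq)
        then show ?thesis unfolding \<omega>_def cis_mult
          by (simp only: cis_mult[symmetric] cis_multiple_2pi[OF Ints_of_int] mult_1_right)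
      qed
      moreover have "(\<Prod>j\<in>UNIV - {i}. cis (2 * pi * of_int (k $ j) * real (s l $ j) / real ?N)) =
          (\<Prod>j\<in>UNIV - {i}. cis (2 * pi * of_int (k $ j) * real (l $ j) / real ?N))"
        by (intro prod.cong) (auto simp: s_def)
      ultimately show ?thesis
        unfolding point by (simp add: prod.remove[of UNIV i] s_def del: of_nat_add)
    qed
    have "(\<Sum>l\<in>grid m. char_exp k (grid_point m l)) = (\<Sum>l\<in>grid m. char_exp k (grid_point m (s l)))"
      by (rule sum.reindex_bij_betw[OF bij, symmetric])
    also have "\<dots> = \<omega> * (\<Sum>l\<in>grid m. char_exp k (grid_point m l))"
      by (simp add: step sum_distrib_left)
    finally show ?thesis unfolding if_not_P[OF False] using \<open>\<omega> \<noteq> 1\<close> by simp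
  qed
qed

subsection \<open>The approximation error\<close>

text \<open>By \<open>char_exp_conv\<close>, V_m(g) equals a trigonometric polynomial at every
  point, so its grid values are determined by finitely many coefficients of g although g itself is
  only square integrable.\<close>

lemma V_op_eq:
  fixes g :: "real^'d::finite \<Rightarrow> real"
  assumes g: "g \<in> L2_torus"
  shows "V_op lam bet m g x =
    (\<Sum>k | linf k \<le> int m. alpha lam bet k * coef (\<lambda>x. complex_of_real (g x)) k * char_exp k x)"
proof -
  let ?G = "\<lambda>x. complex_of_real (g x)"
  note gL = L2_torusD[OF g]
  note [measurable] = sq_int_measurable[OF gL(3)]
  have [measurable]: "H_kernel lam bet m \<in> borel_measurable borel"
    unfolding H_kernel_def[abs_def] by measurable
  have int: "integrable torus_measure (\<lambda>y. char_exp k y * ?G (x - y))" for k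
  proof -
    have "integrable torus_measure (\<lambda>y. (?G (x + (- 1) *\<^sub>R y)))"
      using sq_int_integrable[OF gL(3)] gL(4) by (subst torus_shift(1)) auto
    then show ?thesis
      by (rule Bochner_Integration.integrable_bound) (auto simp: norm_mult)
  qed
  have "V_op lam bet m g x = (LINT y|torus_measure. H_kernel lam bet m y * ?G (x - y))"
    unfolding V_op_def by (rule torus_conv_eq) measurable
  also have "\<dots> = (LINT y|torus_measure. (\<Sum>k | linf k \<le> int m. alpha lam bet k * (char_exp k y * ?G (x - y))))"
    by (simp add: H_kernel_def sum_distrib_right mult.assoc)
  also have "\<dots> = (\<Sum>k | linf k \<le> int m. alpha lam bet k * (LINT y|torus_measure. char_exp k y * ?G (x - y)))"
    using int by (subst Bochner_Integration.integral_sum) auto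
  also have "\<dots> = (\<Sum>k | linf k \<le> int m. alpha lam bet k * coef ?G k * char_exp k x)"
    by (simp add: char_exp_conv[OF _ gL(4)] mult.assoc)
  finally show ?thesis .
qed

lemma Q_op_alt:
  "Q_op lam bet \<phi> \<psi> m f x = (\<Sum>l\<in>grid m.
     (V_op lam bet m (generator \<phi> f) (grid_point m l) / of_nat ((2 * m + 1) ^ CARD('d))) *
     of_real (\<psi> (x - grid_point m l)))"
  for \<psi> :: "real^'d::finite \<Rightarrow> real"
  by (simp add: Q_op_def grid_def sum_divide_distrib)

lemma sq_int_Q_op:
  assumes "\<psi> \<in> L2_torus"
  shows "sq_int (Q_op lam bet \<phi> \<psi> m f)"
  unfolding Q_op_alt[abs_def]
  using L2_torusD(3,4)[OF assms]
  by (intro sq_int_sum sq_int_mult sq_int_translate[where F = "\<lambda>x. complex_of_real (\<psi> x)"]) auto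

lemma coef_Q_op:
  fixes \<psi> :: "real^'d::finite \<Rightarrow> real"
  assumes \<psi>: "\<psi> \<in> L2_torus" "\<And>k. coef (\<lambda>x. complex_of_real (\<psi> x)) k = inverse (bet k)"
    and g: "generator \<phi> f \<in> L2_torus"
  shows "coef (Q_op lam bet \<phi> \<psi> m f) k =
    gamma lam bet m k * coef (\<lambda>x. complex_of_real (generator \<phi> f x)) (residue_vec m k)"
proof -
  let ?P = "\<lambda>x. complex_of_real (\<psi> x)" and ?n = "of_nat ((2 * m + 1) ^ CARD('d)) :: complex"
  define b where "b k = alpha lam bet k * coef (\<lambda>x. complex_of_real (generator \<phi> f x)) k" for k
  define B where "B = {k :: int^'d. linf k \<le> int m}"
  have B: "finite B" "residue_vec m k \<in> B"
    by (simp_all add: B_def finite_linf_le residue_vec_linf)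
  note L = L2_torusD(3,4)[OF \<psi>(1)]
  have n: "?n \<noteq> 0" unfolding of_nat_eq_0_iff by simp
  have "coef (Q_op lam bet \<phi> \<psi> m f) k = (\<Sum>l\<in>grid m.
     (V_op lam bet m (generator \<phi> f) (grid_point m l) / ?n) * coef (\<lambda>x. ?P (x - grid_point m l)) k)"
    unfolding Q_op_alt[abs_def]
    by (subst coef_sum) (simp_all only: coef_mult sq_int_mult sq_int_translate[where F = ?P, OF L])
  also have "\<dots> = (\<Sum>l\<in>grid m. (V_op lam bet m (generator \<phi> f) (grid_point m l) / ?n) *
      (char_exp (- k) (grid_point m l) * inverse (bet k)))"
    by (simp only: coef_translate[OF sq_int_measurable[OF L(1)] L(2)] \<psi>(2))
  \<comment> \<open>The phase of V_m(g) at a grid point and that of the translated \<psi> combine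
    into one character of frequency k' - k.\<close>
  also have "\<dots> = inverse (bet k) / ?n * (\<Sum>l\<in>grid m. \<Sum>k'\<in>B. b k' * char_exp (k' - k) (grid_point m l))"
    unfolding V_op_eq[OF g] diff_conv_add_uminus char_exp_add b_def B_def
    by (simp add: sum_distrib_left sum_distrib_right sum_divide_distrib mult_ac)
  also have "(\<Sum>l\<in>grid m. \<Sum>k'\<in>B. b k' * char_exp (k' - k) (grid_point m l)) =
      (\<Sum>k'\<in>B. b k' * (\<Sum>l\<in>grid m. char_exp (k' - k) (grid_point m l)))"
    by (subst sum.swap) (simp add: sum_distrib_left)
  also have "\<dots> = (\<Sum>k'\<in>B. if k' = residue_vec m k then b k' * ?n else 0)"
  proof (intro sum.cong refl)
    fix k' assume "k' \<in> B"
    then have "(\<forall>j. (2 * int m + 1) dvd (k' - k) $ j) \<longleftrightarrow> k' = residue_vec m k"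
      using residue_vec_unique[of k' m k] by (simp add: B_def)
    then show "b k' * (\<Sum>l\<in>grid m. char_exp (k' - k) (grid_point m l)) =
        (if k' = residue_vec m k then b k' * ?n else 0)"
      by (simp only: sum_char_exp_grid) simp
  qed
  also have "\<dots> = b (residue_vec m k) * ?n"
    using B by simp
  also have "inverse (bet k) / ?n * (b (residue_vec m k) * ?n) = inverse (bet k) * b (residue_vec m k)"
    using n by (simp del: of_nat_power)
  finally show ?thesis by (simp add: gamma_def b_def)
qed

lemma generatorD:
  assumes "f \<in> Phi_space \<phi>"
  shows "is_generator \<phi> f (generator \<phi> f)" "generator \<phi> f \<in> L2_torus" "f \<in> L2_torus"
proof -
  show "f \<in> L2_torus" using assms by (simp add: Phi_space_def)
  show "is_generator \<phi> f (generator \<phi> f)"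
  proof -
    have "\<exists>g. is_generator \<phi> f g" using assms by (simp add: Phi_space_def)
    then show ?thesis unfolding generator_def by (rule someI_ex)
  qed
  then show "generator \<phi> f \<in> L2_torus" by (simp add: is_generator_def)
qed

text \<open>By \<open>residue_quot\<close>, k itself is one of the shifted indices over which the
  maximum is taken, namely the one at its own residue.\<close>

lemma cmod_gamma_le_Gamma_max:
  "cmod (gamma lam bet m k) \<le> Gamma_max lam bet m (quot_vec m k)"
  unfolding Gamma_max_def
  using residue_quot[of m k] residue_vec_linf[of m k] finite_linf_le[of "int m"]
  by (intro Max_ge image_eqI[of _ _ "residue_vec m k"]) auto

text \<open>Since k is determined by its quotient and residue, the sum over K is part of a double
  sum over quotients j and residues k'. Bounding |\<gamma>_k| by a quantity that depends on j alone
  separates the variables, so the double sum factorises.\<close>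

lemma sum_alias_le:
  fixes G :: "int^'d::finite \<Rightarrow> complex"
  assumes K: "finite K" "\<And>k. k \<in> K \<Longrightarrow> \<not> linf k \<le> int m"
    and s: "(\<lambda>j. (Gamma_max lam bet m j)\<^sup>2) summable_on {j. linf j > 0}"
    and G: "(\<Sum>k | linf k \<le> int m. (cmod (G k))\<^sup>2) \<le> B"
  shows "(\<Sum>k\<in>K. (cmod (gamma lam bet m k * G (residue_vec m k)))\<^sup>2) \<le>
    (\<Sum>\<^sub>\<infinity>j | linf j > 0. (Gamma_max lam bet m j)\<^sup>2) * B"
proof -
  let ?\<Gamma> = "\<lambda>j. (Gamma_max lam bet m j)\<^sup>2"
  define J where "J = quot_vec m ` K"
  have J: "finite J" "J \<subseteq> {j. linf j > 0}" using K quot_vec_pos by (auto simp: J_def)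
  let ?p = "\<lambda>k. (quot_vec m k, residue_vec m k)"
  have inj: "inj_on ?p K"
    by (rule inj_onI) (metis residue_quot Pair_inject)
  have "(\<Sum>k\<in>K. (cmod (gamma lam bet m k * G (residue_vec m k)))\<^sup>2) \<le>
      (\<Sum>k\<in>K. ?\<Gamma> (quot_vec m k) * (cmod (G (residue_vec m k)))\<^sup>2)"
    unfolding norm_mult power_mult_distrib
    by (intro sum_mono mult_right_mono power_mono cmod_gamma_le_Gamma_max) auto
  also have "\<dots> = (\<Sum>(j, k')\<in>?p ` K. ?\<Gamma> j * (cmod (G k'))\<^sup>2)"
    by (subst sum.reindex[OF inj]) (simp add: o_def)
  also have "\<dots> \<le> (\<Sum>(j, k')\<in>J \<times> {k. linf k \<le> int m}. ?\<Gamma> j * (cmod (G k'))\<^sup>2)"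
    using J by (intro sum_mono2) (auto simp: finite_linf_le J_def residue_vec_linf)
  also have "\<dots> = (\<Sum>j\<in>J. ?\<Gamma> j) * (\<Sum>k | linf k \<le> int m. (cmod (G k))\<^sup>2)"
    by (simp add: sum_product sum.cartesian_product)
  also have "\<dots> \<le> (\<Sum>\<^sub>\<infinity>j | linf j > 0. ?\<Gamma> j) * B"
  proof (rule mult_mono)
    show "(\<Sum>j\<in>J. ?\<Gamma> j) \<le> (\<Sum>\<^sub>\<infinity>j | linf j > 0. ?\<Gamma> j)"
      using s J by (intro finite_sum_le_infsum) auto
    show "0 \<le> (\<Sum>\<^sub>\<infinity>j | linf j > 0. ?\<Gamma> j)" by (intro infsum_nonneg) auto
  qed (use G in \<open>auto intro: sum_nonneg\<close>)
  finally show ?thesis .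
qed

section \<open>Error estimates under the assumptions of the theorem\<close>

context
  fixes lam bet :: "int^'d::finite \<Rightarrow> complex" and \<phi>lam \<phi>bet :: "real^'d \<Rightarrow> real"
  assumes lam: "\<And>k. lam k \<noteq> 0" and bet: "\<And>k. bet k \<noteq> 0"
    and L2_lam: "\<phi>lam \<in> L2_torus" and series_lam: "distributional_series \<phi>lam (\<lambda>k. inverse (lam k))"
    and L2_bet: "\<phi>bet \<in> L2_torus" and series_bet: "distributional_series \<phi>bet (\<lambda>k. inverse (bet k))"
begin

lemma sq_int_error:
  assumes "f \<in> Phi_space \<phi>lam"
  shows "sq_int (\<lambda>x. complex_of_real (f x) - Q_op lam bet \<phi>lam \<phi>bet m f x)"
  using L2_torusD(3)[OF generatorD(3)[OF assms]] by (intro sq_int_diff sq_int_Q_op L2_bet)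

text \<open>At low frequencies k is its own residue, and \<alpha>_k = \<beta>_k / \<lambda>_k
  cancels the factor 1 / \<beta>_k, leaving exactly the coefficient of f.\<close>

lemma coef_error:
  fixes m :: nat
  assumes f: "f \<in> Phi_space \<phi>lam"
  defines "G \<equiv> coef (\<lambda>x. complex_of_real (generator \<phi>lam f x))"
  shows "coef (\<lambda>x. complex_of_real (f x) - Q_op lam bet \<phi>lam \<phi>bet m f x) k =
    (if linf k \<le> int m then 0 else inverse (lam k) * G k - gamma lam bet m k * G (residue_vec m k))"
proof -
  note g = generatorD[OF f]
  have "coef (\<lambda>x. complex_of_real (f x) - Q_op lam bet \<phi>lam \<phi>bet m f x) k =
      inverse (lam k) * G k - gamma lam bet m k * G (residue_vec m k)"
    unfolding G_def
    by (simp add: coef_diff[OF L2_torusD(3)[OF g(3)] sq_int_Q_op[OF L2_bet]]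
        coef_Phi[OF g(3) L2_lam g(1)] coef_distributional[OF L2_lam series_lam]
        coef_Q_op[OF L2_bet coef_distributional[OF L2_bet series_bet] g(2)])
  then show ?thesis
    using lam bet by (auto simp: gamma_def alpha_def residue_vec_same field_simps)
qed

text \<open>The estimate within the reals, for any common bound E of the two quantities in the
  maximum; \<epsilon>_m itself may be infinite and enters only in \<open>error_le\<close>.\<close>

lemma error_finite:
  assumes f: "f \<in> Phi_space \<phi>lam" and E: "0 \<le> E"
    and low: "\<And>k. linf k \<ge> int m \<Longrightarrow> cmod (inverse (lam k)) \<le> E"
    and s: "(\<lambda>j. (Gamma_max lam bet m j)\<^sup>2) summable_on {j. linf j > 0}"
    and al: "(\<Sum>\<^sub>\<infinity>j | linf j > 0. (Gamma_max lam bet m j)\<^sup>2) \<le> E\<^sup>2"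
  shows "L2_norm (\<lambda>x. complex_of_real (f x) - Q_op lam bet \<phi>lam \<phi>bet m f x) \<le> 2 * E * Phi_norm \<phi>lam f"
proof -
  let ?F = "\<lambda>x. complex_of_real (f x) - Q_op lam bet \<phi>lam \<phi>bet m f x"
  note g = generatorD[OF f]
  note gL = L2_torusD[OF g(2)]
  define G where "G = coef (\<lambda>x. complex_of_real (generator \<phi>lam f x))"
  define N where "N = (LINT x|torus_measure. (generator \<phi>lam f x)\<^sup>2)"
  have N: "0 \<le> N" "Phi_norm \<phi>lam f = sqrt N"
    using gL(2) by (simp_all add: N_def Phi_norm_def L2_norm_eq)
  have bessel: "(\<Sum>k\<in>K. (cmod (G k))\<^sup>2) \<le> N" if "finite K" for K
    using Bessel[OF gL(3) that] by (simp add: G_def N_def)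
  have "(LINT x|torus_measure. (cmod (?F x))\<^sup>2) \<le> 4 * E\<^sup>2 * N"
  proof (rule Parseval_le[OF sq_int_error[OF f]])
    fix K :: "(int^'d) set" assume K: "finite K"
    define K' where "K' = {k \<in> K. \<not> linf k \<le> int m}"
    have K': "finite K'" using K by (simp add: K'_def)
    \<comment> \<open>Only frequencies outside the box survive; the difference is written as a sum
      with a negated term to fit \<open>norm_add_sq\<close>.\<close>
    have "(\<Sum>k\<in>K. (cmod (coef ?F k))\<^sup>2) =
        (\<Sum>k\<in>K'. (cmod (inverse (lam k) * G k + - (gamma lam bet m k * G (residue_vec m k))))\<^sup>2)"
      using K unfolding K'_def coef_error[OF f] G_def[symmetric]
      by (intro sum.mono_neutral_cong_right) auto
    also have "\<dots> \<le> (\<Sum>k\<in>K'. 2 * (cmod (inverse (lam k) * G k))\<^sup>2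
        + 2 * (cmod (- (gamma lam bet m k * G (residue_vec m k))))\<^sup>2)"
      by (intro sum_mono norm_add_sq)
    also have "\<dots> = 2 * (\<Sum>k\<in>K'. (cmod (inverse (lam k) * G k))\<^sup>2)
        + 2 * (\<Sum>k\<in>K'. (cmod (gamma lam bet m k * G (residue_vec m k)))\<^sup>2)"
      by (simp add: sum.distrib sum_distrib_left)
    also have "(\<Sum>k\<in>K'. (cmod (inverse (lam k) * G k))\<^sup>2) \<le> E\<^sup>2 * N"
    proof -
      have "(\<Sum>k\<in>K'. (cmod (inverse (lam k) * G k))\<^sup>2) \<le> (\<Sum>k\<in>K'. E\<^sup>2 * (cmod (G k))\<^sup>2)"
        unfolding norm_mult power_mult_distrib
        by (intro sum_mono mult_right_mono power_mono low) (auto simp: K'_def)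
      also have "\<dots> = E\<^sup>2 * (\<Sum>k\<in>K'. (cmod (G k))\<^sup>2)" by (simp add: sum_distrib_left)
      also have "\<dots> \<le> E\<^sup>2 * N" using bessel[OF K'] by (intro mult_left_mono) auto
      finally show ?thesis .
    qed
    also have "(\<Sum>k\<in>K'. (cmod (gamma lam bet m k * G (residue_vec m k)))\<^sup>2) \<le> E\<^sup>2 * N"
    proof -
      have "(\<Sum>k\<in>K'. (cmod (gamma lam bet m k * G (residue_vec m k)))\<^sup>2) \<le>
          (\<Sum>\<^sub>\<infinity>j | linf j > 0. (Gamma_max lam bet m j)\<^sup>2) * N"
        by (intro sum_alias_le K' s bessel finite_linf_le) (simp add: K'_def)
      also have "\<dots> \<le> E\<^sup>2 * N" using al N(1) by (rule mult_right_mono)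
      finally show ?thesis .
    qed
    finally show "(\<Sum>k\<in>K. (cmod (coef ?F k))\<^sup>2) \<le> 4 * E\<^sup>2 * N" by (simp add: algebra_simps)
  qed
  then have "L2_norm ?F \<le> sqrt (4 * E\<^sup>2 * N)"
    using sq_int_measurable[OF sq_int_error[OF f, of m]] by (simp add: L2_norm_eq)
  also have "\<dots> = 2 * E * Phi_norm \<phi>lam f"
    using E N by (simp add: real_sqrt_mult)
  finally show ?thesis .
qed

text \<open>Needed when $\varepsilon_m = \infty$, because $\infty \cdot 0 = 0$ in \<^typ>\<open>ennreal\<close>.\<close>
lemma error_zero:
  assumes f: "f \<in> Phi_space \<phi>lam" and 0: "Phi_norm \<phi>lam f = 0"
  shows "L2_norm (\<lambda>x. complex_of_real (f x) - Q_op lam bet \<phi>lam \<phi>bet m f x) = 0"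
proof -
  let ?F = "\<lambda>x. complex_of_real (f x) - Q_op lam bet \<phi>lam \<phi>bet m f x"
  note gL = L2_torusD[OF generatorD(2)[OF f]]
  have "(LINT x|torus_measure. (generator \<phi>lam f x)\<^sup>2) = 0"
    using 0 gL(2) by (simp add: Phi_norm_def L2_norm_eq)
  then have G: "coef (\<lambda>x. complex_of_real (generator \<phi>lam f x)) k = 0" for k
    using Bessel[OF gL(3), of "{k}"] by simp
  have "(LINT x|torus_measure. (cmod (?F x))\<^sup>2) \<le> 0"
    by (rule Parseval_le[OF sq_int_error[OF f]]) (simp add: coef_error[OF f] G cong: if_cong)
  then have "(LINT x|torus_measure. (cmod (?F x))\<^sup>2) = 0" by (intro antisym) auto
  then show ?thesis
    using sq_int_measurable[OF sq_int_error[OF f, of m]] by (simp add: L2_norm_eq)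
qed

lemma error_le:
  assumes f: "f \<in> Phi_space \<phi>lam"
  shows "ennreal (L2_norm (\<lambda>x. complex_of_real (f x) - Q_op lam bet \<phi>lam \<phi>bet m f x))
         \<le> ennreal 2 * eps lam bet m * ennreal (Phi_norm \<phi>lam f)"
proof (cases "eps lam bet m = \<infinity>")
  case True
  have "0 \<le> Phi_norm \<phi>lam f" by (simp add: Phi_norm_def L2_norm_def set_lebesgue_integral_def)
  then consider "Phi_norm \<phi>lam f = 0" | "Phi_norm \<phi>lam f > 0" by linarith
  then show ?thesis
  proof cases
    case 1
    then show ?thesis by (simp add: error_zero[OF f])
  next
    case 2
    then show ?thesis using True by (simp add: ennreal_mult_top ennreal_top_mult)
  qed
next
  case False
  define E where "E = enn2real (eps lam bet m)"
  have E: "0 \<le> E" "ennreal E = eps lam bet m" using False by (simp_all add: E_def less_top)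
  have low: "cmod (inverse (lam k)) \<le> E" if "linf k \<ge> int m" for k
  proof -
    have "ennreal (cmod (inverse (lam k))) \<le> (SUP k\<in>{k. linf k \<ge> int m}. ennreal (cmod (inverse (lam k))))"
      using that by (intro SUP_upper) auto
    also have "\<dots> \<le> ennreal E" unfolding E(2) eps_def by simp
    finally show ?thesis using E(1) by simp
  qed
  have al: "alias_term lam bet m \<le> ennreal E" unfolding E(2) eps_def by simp
  \<comment> \<open>Finiteness of the alias term already encodes summability, its value being
    infinite otherwise.\<close>
  then have s: "(\<lambda>j. (Gamma_max lam bet m j)\<^sup>2) summable_on {j. linf j > 0}"
    by (rule_tac ccontr) (simp add: alias_term_def top_unique)
  then have "sqrt (\<Sum>\<^sub>\<infinity>j | linf j > 0. (Gamma_max lam bet m j)\<^sup>2) \<le> E"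
    using al E(1) by (simp add: alias_term_def)
  then have "(\<Sum>\<^sub>\<infinity>j | linf j > 0. (Gamma_max lam bet m j)\<^sup>2) \<le> E\<^sup>2"
    using E(1) by (simp add: real_sqrt_le_iff real_le_lsqrt sqrt_le_D)
  from error_finite[OF f E(1) low s this]
  have "ennreal (L2_norm (\<lambda>x. complex_of_real (f x) - Q_op lam bet \<phi>lam \<phi>bet m f x)) \<le>
      ennreal (2 * E * Phi_norm \<phi>lam f)" by (intro ennreal_leI)
  also have "\<dots> = ennreal 2 * ennreal E * ennreal (Phi_norm \<phi>lam f)"
    using E(1) by (simp add: ennreal_mult' Phi_norm_def L2_norm_def set_lebesgue_integral_def ennreal_mult'')
  finally show ?thesis unfolding E(2) .
qed

text \<open>The values of \<open>V_op\<close> are complex while the admissible coefficients are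
  real. As f and \<open>\<phi>bet\<close> are real, replacing the coefficients by their real parts
  replaces the error by its real part, whose norm is no larger.\<close>

lemma M_approx_le:
  "M_approx ((2 * m + 1) ^ CARD('d)) (Phi_ball \<phi>lam) \<phi>bet \<le> ennreal 2 * eps lam bet m"
  unfolding M_approx_def
proof (rule SUP_least)
  let ?n = "(2 * m + 1) ^ CARD('d)"
  fix f assume "f \<in> Phi_ball \<phi>lam"
  then have f: "f \<in> Phi_space \<phi>lam" and le1: "Phi_norm \<phi>lam f \<le> 1" by (auto simp: Phi_ball_def)
  let ?F = "\<lambda>x. complex_of_real (f x) - Q_op lam bet \<phi>lam \<phi>bet m f x"
  \<comment> \<open>The grid has exactly (2m + 1)^d points and is enumerated from 1 to fit the sum
    in \<open>M_approx\<close>.\<close>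
  obtain h where h: "bij_betw h {1..?n} (grid m :: (nat^'d) set)"
    using ex_bij_betw_nat_finite_1[OF finite_grid[of m, where 'd = 'd]] unfolding card_grid by blast
  define c where "c l = Re (V_op lam bet m (generator \<phi>lam f) (grid_point m (h l)) / of_nat ?n)" for l
  \<comment> \<open>\<open>M_approx\<close> wants a node in the cube for every index, also outside
    the range of the sum; there 0 is the default.\<close>
  define y where "y l = (if l \<in> {1..?n} then grid_point m (h l) else (0 :: real^'d))" for l
  have y: "y l \<in> torus_cube" for l
  proof (cases "l \<in> {1..?n}")
    case True
    then have "h l \<in> grid m" using h by (auto simp: bij_betw_def)
    then have "h l $ j \<le> 2 * m + 1" for j by (simp add: grid_def le_SucI)
    then have "real (h l $ j) / real (2 * m + 1) \<le> 1" for j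
      unfolding divide_le_eq_1 of_nat_le_iff by simp
    then have "2 * pi * (real (h l $ j) / real (2 * m + 1)) \<le> 2 * pi * 1" for j
      by (intro mult_left_mono) auto
    then show ?thesis using True by (simp add: y_def torus_cube_def grid_point_def mem_box_cart)
  next
    case False
    then show ?thesis by (simp only: y_def if_False) (simp add: torus_cube_def mem_box_cart)
  qed
  have re: "f x - (\<Sum>l=1..?n. c l * \<phi>bet (x - y l)) = Re (?F x)" for x
  proof -
    have "(\<Sum>l=1..?n. c l * \<phi>bet (x - y l)) =
      (\<Sum>l\<in>{1..?n}. Re (V_op lam bet m (generator \<phi>lam f) (grid_point m (h l)) / of_nat ?n) *
         \<phi>bet (x - grid_point m (h l)))"
      by (intro sum.cong) (simp_all only: c_def y_def if_True)
    also have "\<dots> = (\<Sum>l\<in>grid m. Re (V_op lam bet m (generator \<phi>lam f) (grid_point m l) / of_nat ?n) *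
         \<phi>bet (x - grid_point m l))"
      by (rule sum.reindex_bij_betw[OF h])
    finally show ?thesis by (simp only: Q_op_alt minus_complex.sel Re_complex_of_real Re_sum times_complex.sel Im_complex_of_real) simp
  qed
  have Fm: "?F \<in> borel_measurable borel" by (rule sq_int_measurable[OF sq_int_error[OF f]])
  have "(\<lambda>x. Re (?F x)) \<in> borel_measurable borel"
    by (rule measurable_compose[OF Fm]) measurable
  then have "L2_norm (\<lambda>x. Re (?F x)) = sqrt (LINT x|torus_measure. (Re (?F x))\<^sup>2)"
    by (simp only: L2_norm_eq real_norm_def power2_abs)
  also have "\<dots> \<le> sqrt (LINT x|torus_measure. (cmod (?F x))\<^sup>2)"
  proof (intro real_sqrt_le_mono integral_mono')
    show "integrable torus_measure (\<lambda>x. (cmod (?F x))\<^sup>2)"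
      using sq_int_error[OF f, of m] by (simp add: sq_int_def)
    show "(Re (?F x))\<^sup>2 \<le> (cmod (?F x))\<^sup>2" for x
      unfolding cmod_power2 by simp
  qed simp
  also have "\<dots> = L2_norm ?F" by (rule L2_norm_eq[OF Fm, symmetric])
  finally have "ennreal (L2_norm (\<lambda>x. f x - (\<Sum>l=1..?n. c l * \<phi>bet (x - y l)))) \<le> ennreal (L2_norm ?F)"
    unfolding re by (rule ennreal_leI)
  also have "\<dots> \<le> ennreal 2 * eps lam bet m * ennreal (Phi_norm \<phi>lam f)" by (rule error_le[OF f])
  also have "\<dots> \<le> ennreal 2 * eps lam bet m * 1"
    using le1 by (intro mult_left_mono) auto
  finally have "ennreal (L2_norm (\<lambda>x. f x - (\<Sum>l=1..?n. c l * \<phi>bet (x - y l)))) \<le> ennreal 2 * eps lam bet m" by simp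
  then show "(INF c. INF y\<in>{y. \<forall>l. y l \<in> torus_cube}. ennreal (L2_norm (\<lambda>x. f x - (\<Sum>l=1..?n. c l * \<phi>bet (x - y l)))))
      \<le> ennreal 2 * eps lam bet m"
    using y by (intro INF_lower2[of c] INF_lower2[of y]) auto
qed

end

theorem theorem3p3:
  fixes lam bet :: "int^'d::finite \<Rightarrow> complex"
    and \<phi>lam \<phi>bet :: "real^'d \<Rightarrow> real"
  assumes "\<forall>k. lam k \<noteq> 0" and "\<forall>k. bet k \<noteq> 0"
    and "\<phi>lam \<in> L2_torus" and "distributional_series \<phi>lam (\<lambda>k. inverse (lam k))"
    and "\<phi>bet \<in> L2_torus" and "distributional_series \<phi>bet (\<lambda>k. inverse (bet k))"
  shows "\<exists>c::real. c > 0 \<and>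
    (\<forall>f \<in> Phi_space \<phi>lam. \<forall>m\<ge>1.
       ennreal (L2_norm (\<lambda>x. complex_of_real (f x) - Q_op lam bet \<phi>lam \<phi>bet m f x))
         \<le> ennreal c * eps lam bet m * ennreal (Phi_norm \<phi>lam f)) \<and>
    (\<forall>m\<ge>1. M_approx ((2 * m + 1) ^ CARD('d)) (Phi_ball \<phi>lam) \<phi>bet
         \<le> ennreal c * eps lam bet m)"
proof (intro exI[of _ 2] conjI ballI allI impI)
  fix f and m :: nat assume "f \<in> Phi_space \<phi>lam"
  then show "ennreal (L2_norm (\<lambda>x. complex_of_real (f x) - Q_op lam bet \<phi>lam \<phi>bet m f x))
         \<le> ennreal 2 * eps lam bet m * ennreal (Phi_norm \<phi>lam f)"
    using assms by (intro error_le) auto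
next
  fix m :: nat
  show "M_approx ((2 * m + 1) ^ CARD('d)) (Phi_ball \<phi>lam) \<phi>bet \<le> ennreal 2 * eps lam bet m"
    using assms by (intro M_approx_le) auto
qed simp

end
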